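(* Let $\varepsilon>0$ and $q\in(0,1]$. Then there is an expander sequence $\mathcal G=(G_n)_{n\in\mathbb N}$ and a sequence of graphs $(\tilde G_n)_{n\in\mathbb N}$ such that each $\tilde G_n$ is obtained by deleting edges of $G_n$ such that each vertex keeps at least a $(1-\varepsilon)$ fraction of its edges, and whp (a) $T_{push}(\tilde G_n,q)\ge c_{push}(q)\log n+\frac{\varepsilon}{2q}\log n+o(\log n)$; (b) $T_{pp}(\tilde G_n,q)\ge c_{pp}(q)\log n+\left(\frac{\varepsilon}{8q}-\frac{\varepsilon q^3}{5}\right)\log n+o(\log n)$.
   Context: Rumour spreading protocols on a connected graph with $n$ vertices, one vertex initially informed, synchronous rounds; each message transmission succeeds independently with probability $q\in(0,1]$. push: in each round every informed vertex chooses a neighbour independently and uniformly at random and (if the transmission succeeds) informs it. push\&pull (pp): in each round every vertex chooses a neighbour independently and uniformly at random, and if one of the two is informed (and the transmission succeeds) both become informed. $T_{\mathcal P}(G,q)$ is the number of rounds until all vertices are informed. $c_{push}(q)=\frac{1}{\log(1+q)}+\frac1q$, $c_{pp}(q)=\frac{1}{\log(1+2q)}+\frac{1}{q-\log(1-q)}$ for $q\in(0,1)$ and $c_{\mathcal P}(1)=\lim_{q\to1}c_{\mathcal P}(q)$; natural log. An expander sequence is a sequence $(G_n)$ of connected graphs, $G_n$ on $n$ vertices with minimum degree $\delta_n$, maximum degree $\Delta_n$, and $\lambda_n=\max\{|\mu_2|,|\mu_n|\}$ (from the adjacency eigenvalues $\mu_1\ge\dots\ge\mu_n$), with $\Delta_n/\delta_n=1+o(1)$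 and $\lambda_n=o(\Delta_n)$. "Keeps at least a $(1-\varepsilon)$ fraction" means $d_{\tilde G_n}(v)\ge(1-\varepsilon)d_{G_n}(v)$. whp means with probability $1-o(1)$ as $n\to\infty$. $a\ge b-o(f)$-type statements: $a\ge b+o(f)$ is understood as $a\ge b-h$ for some positive $h=o(f)$. *)

theory Defs
  imports "HOL-Probability.Probability" "HOL-Library.Landau_Symbols"
    "Jordan_Normal_Form.Char_Poly"
begin

definition graph_on :: "nat \<Rightarrow> nat set set \<Rightarrow> bool" where
  "graph_on n E \<longleftrightarrow> (\<forall>e\<in>E. e \<subseteq> {..<n} \<and> card e = 2)"

definition nbrs :: "nat set set \<Rightarrow> nat \<Rightarrow> nat set" where
  "nbrs E v = {u. {u, v} \<in> E}"

definition degree :: "nat set set \<Rightarrow> nat \<Rightarrow> nat" where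
  "degree E v = card (nbrs E v)"

definition connected_graph :: "nat \<Rightarrow> nat set set \<Rightarrow> bool" where
  "connected_graph n E \<longleftrightarrow> graph_on n E \<and>
     (\<forall>u<n. \<forall>v<n. (\<lambda>x y. {x, y} \<in> E)\<^sup>*\<^sup>* u v)"

definition min_degree :: "nat \<Rightarrow> nat set set \<Rightarrow> nat" where
  "min_degree n E = Min (degree E ` {..<n})"

definition max_degree :: "nat \<Rightarrow> nat set set \<Rightarrow> nat" where
  "max_degree n E = Max (degree E ` {..<n})"

definition adj_matrix :: "nat \<Rightarrow> nat set set \<Rightarrow> real mat" where
  "adj_matrix n E = mat n n (\<lambda>(i, j). if {i, j} \<in> E then 1 else 0)"

text \<open>Adjacency eigenvalues (with multiplicity) in increasing order; the paper's
  mu_1 >= ... >= mu_n is the reverse of this list, so mu_2 = list ! (n-2), mu_n = list ! 0.\<close>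

definition adj_eigs_sorted :: "nat \<Rightarrow> nat set set \<Rightarrow> real list" where
  "adj_eigs_sorted n E = sorted_list_of_multiset (proots (char_poly (adj_matrix n E)))"

definition lambda_spec :: "nat \<Rightarrow> nat set set \<Rightarrow> real" where
  "lambda_spec n E = max \<bar>adj_eigs_sorted n E ! (n - 2)\<bar> \<bar>adj_eigs_sorted n E ! 0\<bar>"

definition expander_seq :: "(nat \<Rightarrow> nat set set) \<Rightarrow> bool" where
  "expander_seq G \<longleftrightarrow>
     (\<forall>n\<ge>1. connected_graph n (G n)) \<and>
     ((\<lambda>n. real (max_degree n (G n)) / real (min_degree n (G n))) \<longlongrightarrow> 1) at_top \<and>
     (\<lambda>n. lambda_spec n (G n)) \<in> o(\<lambda>n. real (max_degree n (G n)))"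

datatype protocol = Push | PushPull

text \<open>Randomness of one round: every vertex v < n chooses a neighbour uniformly at random
  (None if it has none) together with an independent success coin of bias q for the
  corresponding transmission.\<close>

definition choice_pmf :: "nat set set \<Rightarrow> nat \<Rightarrow> nat option pmf" where
  "choice_pmf E v = (if nbrs E v = {} then return_pmf None
                     else map_pmf Some (pmf_of_set (nbrs E v)))"

definition round_pmf :: "nat \<Rightarrow> nat set set \<Rightarrow> real \<Rightarrow> (nat \<Rightarrow> nat option \<times> bool) pmf" where
  "round_pmf n E q = Pi_pmf {..<n} (None, False) (\<lambda>v. pair_pmf (choice_pmf E v) (bernoulli_pmf q))"

definition rumour_space :: "nat \<Rightarrow> nat set set \<Rightarrow> real \<Rightarrow> (nat \<Rightarrow> nat \<Rightarrow> nat option \<times> bool) measure" where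
  "rumour_space n E q = PiM UNIV (\<lambda>_::nat. measure_pmf (round_pmf n E q))"

fun informed :: "protocol \<Rightarrow> nat \<Rightarrow> nat \<Rightarrow> (nat \<Rightarrow> nat \<Rightarrow> nat option \<times> bool) \<Rightarrow> nat \<Rightarrow> nat set" where
  "informed P n s \<omega> 0 = {s}"
| "informed Push n s \<omega> (Suc t) =
     informed Push n s \<omega> t \<union>
     {u. \<exists>v<n. v \<in> informed Push n s \<omega> t \<and> fst (\<omega> t v) = Some u \<and> snd (\<omega> t v)}"
| "informed PushPull n s \<omega> (Suc t) =
     informed PushPull n s \<omega> t \<union>
     {x. \<exists>v<n. \<exists>u. fst (\<omega> t v) = Some u \<and> snd (\<omega> t v) \<and>
          (v \<in> informed PushPull n s \<omega> t \<or> u \<in> informed PushPull n s \<omega> t) \<and> (x = v \<or> x = u)}"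

text \<open>Number of rounds until all vertices are informed (infinity if this never happens).\<close>

definition rounds :: "protocol \<Rightarrow> nat \<Rightarrow> nat \<Rightarrow> (nat \<Rightarrow> nat \<Rightarrow> nat option \<times> bool) \<Rightarrow> enat" where
  "rounds P n s \<omega> = Inf {enat t | t. informed P n s \<omega> t = {..<n}}"

definition prob_T_less :: "protocol \<Rightarrow> nat \<Rightarrow> nat set set \<Rightarrow> real \<Rightarrow> nat \<Rightarrow> real \<Rightarrow> real" where
  "prob_T_less P n E q s x =
     measure (rumour_space n E q) {\<omega> \<in> space (rumour_space n E q). \<exists>t. rounds P n s \<omega> = enat t \<and> real t < x}"

definition c_push_formula :: "real \<Rightarrow> real" where
  "c_push_formula q = 1 / ln (1 + q) + 1 / q"

definition c_pp_formula :: "real \<Rightarrow> real" where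
  "c_pp_formula q = 1 / ln (1 + 2 * q) + 1 / (q - ln (1 - q))"

definition c_push :: "real \<Rightarrow> real" where
  "c_push q = (if q < 1 then c_push_formula q else Lim (at_left 1) c_push_formula)"

definition c_pp :: "real \<Rightarrow> real" where
  "c_pp q = (if q < 1 then c_pp_formula q else Lim (at_left 1) c_pp_formula)"

end

theory Submission
  imports Defs "HOL-Real_Asymp.Real_Asymp"
begin

text \<open>
  Take the complete graphs. If \<open>\<epsilon> \<ge> 1\<close>, thin them out to paths, where the rumour needs at least
  about \<open>n / 2\<close> rounds. If \<open>\<epsilon> < 1\<close>, choose a set \<open>A\<close> of about \<open>n / ln n\<close> vertices and a set
  \<open>D \<supseteq> A\<close> of about \<open>\<epsilon> n\<close> vertices, and delete all edges between \<open>A\<close> and \<open>D\<close>. As \<open>A\<close> is sparse,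
  in expectation the number of informed vertices still grows per round by a factor of at most
  \<open>1 + q\<close> for push and \<open>1 + 2 q + o(1)\<close> for push and pull, so after almost
  \<open>ln n / ln (1 + q)\<close>, respectively \<open>ln n / ln (1 + 2 q)\<close>, rounds at most half of \<open>A\<close> is informed.
  From then on a vertex of \<open>A\<close> survives a round with probability about \<open>exp (- q (1 - \<epsilon>))\<close>
  (times \<open>1 - q\<close> if it may pull), even if everybody else is informed. These survivals are
  negatively correlated, so by Chebyshev's inequality some vertex of \<open>A\<close> survives
  \<open>(1 - o(1)) ln n / (q (1 - \<epsilon>))\<close>, respectively \<open>(1 - o(1)) ln n / (q (1 - \<epsilon>) - ln (1 - q))\<close>,
  further rounds. These constants exceed the required ones strictly, so a constant suffices as
  error term.
\<close>

section \<open>The complete graph\<close>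

definition complete_edges :: "nat \<Rightarrow> nat set set" where
  "complete_edges n = {e. e \<subseteq> {..<n} \<and> card e = 2}"

lemma insert_in_complete_edges: "{i, j} \<in> complete_edges n \<longleftrightarrow> i < n \<and> j < n \<and> i \<noteq> j"
  by (auto simp: complete_edges_def card_insert_if)

lemma degree_complete_edges: "v < n \<Longrightarrow> degree (complete_edges n) v = n - 1"
proof -
  assume "v < n"
  then have "nbrs (complete_edges n) v = {..<n} - {v}"
    by (auto simp: nbrs_def insert_in_complete_edges)
  then show ?thesis using \<open>v < n\<close> by (simp add: degree_def)
qed

text \<open>Edges are unordered pairs, so reachability is symmetric and any two vertices are joined
  through the hub \<open>c\<close>.\<close>

lemma connected_graphI:
  assumes "graph_on n E" "\<And>v. v < n \<Longrightarrow> (\<lambda>x y. {x, y} \<in> E)\<^sup>*\<^sup>* c v"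
  shows "connected_graph n E"
proof -
  let ?R = "\<lambda>x y. {x, y} \<in> E"
  have "symp ?R" by (auto simp: symp_def insert_commute)
  then have "symp ?R\<^sup>*\<^sup>*" by (rule symp_rtranclp)
  then have "?R\<^sup>*\<^sup>* u v" if "u < n" "v < n" for u v
    using assms(2)[OF that(1)] assms(2)[OF that(2)] by (meson rtranclp_trans sympD)
  with assms(1) show ?thesis by (simp add: connected_graph_def)
qed

lemma connected_complete_edges: "connected_graph n (complete_edges n)"
proof (rule connected_graphI)
  show "graph_on n (complete_edges n)" by (auto simp: graph_on_def complete_edges_def)
  fix v assume "v < n"
  then show "(\<lambda>x y. {x, y} \<in> complete_edges n)\<^sup>*\<^sup>* 0 v"
    by (cases "v = 0") (auto simp: insert_in_complete_edges intro: r_into_rtranclp)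
qed

section \<open>Spectrum of the complete graph\<close>

lemma proots_prod_linear: "proots (\<Prod>a\<leftarrow>xs. [:- a, 1:]) = mset (xs :: real list)"
proof (induction xs)
  case (Cons a xs)
  have "(\<Prod>a\<leftarrow>xs. [:- a, 1:]) \<noteq> 0" by (auto simp: prod_list_zero_iff)
  then show ?case
    unfolding list.map prod_list.Cons using Cons by (subst proots_mult) auto
qed simp

text \<open>In the basis consisting of the all-ones vector and the unit vectors \<open>e\<^sub>1, \<dots>, e\<^sub>n\<^sub>-\<^sub>1\<close>, the adjacency
  matrix of the complete graph is upper triangular.\<close>

lemma proots_char_poly_complete:
  assumes "n \<ge> 1"
  shows "proots (char_poly (adj_matrix n (complete_edges n))) = mset ((real n - 1) # replicate (n - 1) (-1))"
proof -
  let ?A = "adj_matrix n (complete_edges n)"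
  define B :: "real mat" where
    "B = mat n n (\<lambda>(i, j). if i = j then if i = 0 then real n - 1 else -1 else if i = 0 then 1 else 0)"
  define P :: "real mat" where "P = mat n n (\<lambda>(i, j). if i = j \<or> j = 0 then 1 else 0)"
  define Q :: "real mat" where "Q = mat n n (\<lambda>(i, j). if i = j then 1 else if j = 0 then -1 else 0)"
  have carr: "?A \<in> carrier_mat n n" "B \<in> carrier_mat n n" "P \<in> carrier_mat n n" "Q \<in> carrier_mat n n"
    by (auto simp: adj_matrix_def B_def P_def Q_def)
  have A: "?A $$ (i, j) = (if i = j then 0 else 1)" if "i < n" "j < n" for i j
    using that by (auto simp: adj_matrix_def insert_in_complete_edges)
  \<comment> \<open>Row \<open>i\<close> of \<open>P\<close> and of \<open>Q\<close> vanishes off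
    the columns \<open>0\<close> and \<open>i\<close>, so every entry of a product with one of them
    on the left has at most two terms.\<close>
  have two: "(\<Sum>k = 0..<n. g k * f k) = g 0 * f 0 + (if i = 0 then 0 else g i * f i)"
    if "i < n" "\<And>k. k \<noteq> 0 \<Longrightarrow> k \<noteq> i \<Longrightarrow> g k = 0" for g f :: "nat \<Rightarrow> real" and i
  proof -
    have "(\<Sum>k = 0..<n. g k * f k) = (\<Sum>k\<in>{0, i}. g k * f k)"
      by (rule sum.mono_neutral_right) (use assms that in auto)
    then show ?thesis by auto
  qed
  have QP: "Q * P = 1\<^sub>m n"
  proof (rule eq_matI)
    fix i j assume ij: "i < dim_row (1\<^sub>m n :: real mat)" "j < dim_col (1\<^sub>m n :: real mat)"
    have "(Q * P) $$ (i, j) = (\<Sum>k = 0..<n. (if i = k then 1 else if k = 0 then -1 else 0) * P $$ (k, j))"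
      using ij carr by (simp add: scalar_prod_def Q_def)
    also have "\<dots> = 1\<^sub>m n $$ (i, j)"
      using ij by (subst two[of i]) (auto simp: P_def)
    finally show "(Q * P) $$ (i, j) = 1\<^sub>m n $$ (i, j)" .
  qed (use carr in auto)
  then have PQ: "P * Q = 1\<^sub>m n" using carr mat_mult_left_right_inverse by blast
  have AP: "?A * P = P * B"
  proof (rule eq_matI)
    fix i j assume "i < dim_row (P * B)" "j < dim_col (P * B)"
    then have ij: "i < n" "j < n" using carr by auto
    have "(?A * P) $$ (i, j) = (\<Sum>k = 0..<n. ?A $$ (i, k) * (if k = j \<or> j = 0 then 1 else 0))"
      using ij carr by (simp add: scalar_prod_def P_def)
    also have "\<dots> = (if j = 0 then real n - 1 else ?A $$ (i, j))"
    proof (cases "j = 0")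
      case True
      have "(\<Sum>k = 0..<n. ?A $$ (i, k)) = (\<Sum>k\<in>{0..<n} - {i}. 1)"
        using ij by (intro sum.mono_neutral_cong_right) (auto simp: A)
      also have "\<dots> = real n - 1" using ij by (simp add: of_nat_diff)
      finally show ?thesis using True by simp
    next
      case False
      then show ?thesis using ij by (simp add: if_distrib[of "\<lambda>x. _ * x"] cong: if_cong)
    qed
    also have "\<dots> = (\<Sum>k = 0..<n. (if i = k \<or> k = 0 then 1 else 0) * B $$ (k, j))"
      using ij by (subst two[of i]) (auto simp: B_def A)
    also have "\<dots> = (P * B) $$ (i, j)"
      using ij carr by (simp add: scalar_prod_def P_def)
    finally show "(?A * P) $$ (i, j) = (P * B) $$ (i, j)" .
  qed (use carr in auto)
  have "?A = ?A * (P * Q)" using carr PQ by simp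
  also have "\<dots> = P * B * Q" using carr AP by (metis assoc_mult_mat)
  finally have "similar_mat_wit ?A B P Q"
    using carr PQ QP by (auto simp: similar_mat_wit_def Let_def)
  then have "char_poly ?A = char_poly B" by (intro char_poly_similar) (auto simp: similar_mat_def)
  also have "\<dots> = (\<Prod>a\<leftarrow>diag_mat B. [:- a, 1:])"
    by (rule char_poly_upper_triangular[OF carr(2)]) (auto simp: B_def upper_triangular_def)
  also have "diag_mat B = (real n - 1) # replicate (n - 1) (-1)"
    by (rule nth_equalityI) (use assms in \<open>auto simp: diag_mat_def B_def nth_Cons'\<close>)
  finally show ?thesis by (simp only: proots_prod_linear)
qed

text \<open>In increasing order the spectrum is a block of \<open>n - 1\<close> copies of
  \<open>-1\<close> followed by \<open>n - 1\<close>; from \<open>n = 2\<close> on, the indices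
  \<open>0\<close> and \<open>n - 2\<close> both fall into the block.\<close>

lemma lambda_spec_complete:
  assumes "n \<ge> 2"
  shows "lambda_spec n (complete_edges n) = 1"
proof -
  have "adj_eigs_sorted n (complete_edges n) = sort ((real n - 1) # replicate (n - 1) (-1))"
    using assms unfolding adj_eigs_sorted_def
    by (simp add: proots_char_poly_complete sorted_list_of_multiset_mset del: mset.simps mset_replicate)
  also have "\<dots> = replicate (n - 1) (-1) @ [real n - 1]"
    by (rule properties_for_sort) (auto simp: sorted_append)
  finally show ?thesis using assms by (simp add: lambda_spec_def nth_append)
qed

lemma expander_seq_complete: "expander_seq complete_edges"
  unfolding expander_seq_def
proof (intro conjI allI impI)
  show "connected_graph n (complete_edges n)" for n by (rule connected_complete_edges)
  have deg: "degree (complete_edges n) ` {..<n} = {n - 1}" if "n \<ge> 2" for n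
    using that degree_complete_edges by (auto simp: image_iff intro!: exI[of _ 0])
  have max: "max_degree n (complete_edges n) = n - 1" and min: "min_degree n (complete_edges n) = n - 1"
    if "n \<ge> 2" for n
    using deg[OF that] by (auto simp: max_degree_def min_degree_def)
  have ev: "eventually (\<lambda>n::nat. n \<ge> 2) at_top" by (rule eventually_ge_at_top)
  show "(\<lambda>n. real (max_degree n (complete_edges n)) / real (min_degree n (complete_edges n))) \<longlonglongrightarrow> 1"
    by (rule tendsto_eventually, use ev in eventually_elim) (simp add: max min)
  have "(\<lambda>n. lambda_spec n (complete_edges n)) \<in> \<Theta>(\<lambda>_. 1)"
    by (rule bigthetaI_cong, use ev in eventually_elim) (simp add: lambda_spec_complete)
  also have "(\<lambda>_. 1 :: real) \<in> o(\<lambda>n. real n - 1)" by real_asymp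
  also have "(\<lambda>n. real n - 1) \<in> \<Theta>(\<lambda>n. real (max_degree n (complete_edges n)))"
    by (rule bigthetaI_cong, use ev in eventually_elim) (simp add: max of_nat_diff)
  finally show "(\<lambda>n. lambda_spec n (complete_edges n)) \<in> o(\<lambda>n. real (max_degree n (complete_edges n)))" .
qed

section \<open>Reduction to a recursion over the rounds\<close>

text \<open>The last set holds the vertices that pull. It is empty for push, so that both protocols
  share one step function and most proofs.\<close>

definition rumour_step :: "protocol \<Rightarrow> nat \<Rightarrow> nat set \<Rightarrow> (nat \<Rightarrow> nat option \<times> bool) \<Rightarrow> nat set" where
  "rumour_step P n I x = I \<union>
     {u. \<exists>v<n. v \<in> I \<and> x v = (Some u, True)} \<union>
     {v. P = PushPull \<and> v < n \<and> (\<exists>u\<in>I. x v = (Some u, True))}"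

lemma rumour_step_mono: "I \<subseteq> J \<Longrightarrow> rumour_step P n I x \<subseteq> rumour_step P n J x"
  unfolding rumour_step_def by blast

lemma finite_rumour_step: "finite I \<Longrightarrow> finite (rumour_step P n I x)"
proof -
  assume "finite I"
  have "rumour_step P n I x \<subseteq> I \<union> (\<lambda>v. the (fst (x v))) ` {..<n} \<union> {..<n}"
    unfolding rumour_step_def by force
  with \<open>finite I\<close> show ?thesis
    by (meson finite_UnI finite_imageI finite_lessThan finite_subset)
qed

text \<open>The initial set is arbitrary because the run that remains after the first round may
  start from several vertices.\<close>

primrec run :: "protocol \<Rightarrow> nat \<Rightarrow> nat set \<Rightarrow> (nat \<Rightarrow> nat \<Rightarrow> nat option \<times> bool) \<Rightarrow> nat \<Rightarrow> nat set" where
  "run P n I \<omega> 0 = I"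
| "run P n I \<omega> (Suc t) = rumour_step P n (run P n I \<omega> t) (\<omega> t)"

lemma informed_eq_run: "informed P n s \<omega> t = run P n {s} \<omega> t"
proof (induction t)
  case (Suc t)
  have eq: "fst (\<omega> t v) = Some u \<and> snd (\<omega> t v) \<longleftrightarrow> \<omega> t v = (Some u, True)" for u v
    by (cases "\<omega> t v") auto
  show ?case
  proof (cases P)
    case Push
    with Suc show ?thesis by (simp add: rumour_step_def eq)
  next
    case PushPull
    with Suc show ?thesis
      by (simp add: rumour_step_def eq flip: conj_assoc) blast
  qed
qed (cases P; simp)

text \<open>Splits off the first round instead of the last, to match the decomposition of the
  sequence space in \<open>PiM_iter\<close>.\<close>

lemma run_case_nat: "run P n I (case_nat x \<omega>) (Suc t) = run P n (rumour_step P n I x) \<omega> t"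
  by (induction t) auto

lemma run_mono_time: "t \<le> t' \<Longrightarrow> run P n I \<omega> t \<subseteq> run P n I \<omega> t'"
  by (induction rule: dec_induct) (auto simp: rumour_step_def)

section \<open>Conditioning on the first round\<close>

lemma measurable_run:
  "Measurable.pred (PiM UNIV (\<lambda>_. measure_pmf p)) (\<lambda>\<omega>. v \<in> run P n I \<omega> t)"
proof (induction t arbitrary: v)
  case (Suc t)
  note [measurable] = Suc
  have [measurable]: "Measurable.pred (PiM UNIV (\<lambda>_. measure_pmf p)) (\<lambda>\<omega>. \<omega> t w = y)" for w y
  proof -
    have "(\<lambda>\<omega>. \<omega> t) \<in> PiM UNIV (\<lambda>_. measure_pmf p) \<rightarrow>\<^sub>M measure_pmf p" by measurable
    moreover have "Measurable.pred (measure_pmf p) (\<lambda>x. x w = y)" by simp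
    ultimately show ?thesis by (rule measurable_compose)
  qed
  show ?case unfolding run.simps rumour_step_def Un_iff mem_Collect_eq Bex_def by measurable
qed auto

text \<open>Conditioning on the first round replaces the infinite product by iterated expectations
  over one round, so that later estimates are inductions on the number of rounds. Inclusion instead
  of equality at the base makes the value monotone in \<open>I\<close>.\<close>

primrec all_informed_prob :: "protocol \<Rightarrow> nat \<Rightarrow> nat set set \<Rightarrow> real \<Rightarrow> nat \<Rightarrow> nat set \<Rightarrow> real" where
  "all_informed_prob P n E q 0 I = (if {..<n} \<subseteq> I then 1 else 0)"
| "all_informed_prob P n E q (Suc t) I =
     measure_pmf.expectation (round_pmf n E q) (\<lambda>x. all_informed_prob P n E q t (rumour_step P n I x))"

lemma all_informed_prob_bounds: "0 \<le> all_informed_prob P n E q t I" "all_informed_prob P n E q t I \<le> 1"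
proof (induction t arbitrary: I)
  case (Suc t)
  { case 1 show ?case using Suc by (auto intro: integral_nonneg) }
  { case 2 show ?case unfolding all_informed_prob.simps
    proof (rule measure_pmf.integral_le_const)
      show "integrable (round_pmf n E q) (\<lambda>x. all_informed_prob P n E q t (rumour_step P n I x))"
        by (rule measure_pmf.integrable_const_bound[where B=1]) (use Suc in auto)
    qed (use Suc in auto) }
qed auto

lemma integrable_all_informed_prob:
  "integrable (measure_pmf p) (\<lambda>x. all_informed_prob P n E q t (f x))"
  by (rule measure_pmf.integrable_const_bound[where B=1]) (use all_informed_prob_bounds in auto)

lemma all_informed_prob_mono:
  "I \<subseteq> J \<Longrightarrow> all_informed_prob P n E q t I \<le> all_informed_prob P n E q t J"
proof (induction t arbitrary: I J)
  case (Suc t)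
  show ?case unfolding all_informed_prob.simps
    by (intro integral_mono integrable_all_informed_prob Suc.IH rumour_step_mono Suc.prems)
qed auto

lemma sets_run_superset:
  "{\<omega> \<in> space (rumour_space n E q). {..<n} \<subseteq> run P n I \<omega> t} \<in> sets (rumour_space n E q)"
proof -
  note [measurable] = measurable_run
  have "{\<omega> \<in> space (rumour_space n E q). \<forall>v\<in>{..<n}. v \<in> run P n I \<omega> t} \<in> sets (rumour_space n E q)"
    unfolding rumour_space_def by measurable
  then show ?thesis unfolding subset_eq .
qed

text \<open>By \<open>PiM_iter\<close>, an independent round put in front of a sequence of rounds
  leaves the law of the sequence unchanged. Fubini then gives an integral over the first round,
  inside which the induction hypothesis applies.\<close>

lemma emeasure_run_superset:
  "emeasure (rumour_space n E q) {\<omega> \<in> space (rumour_space n E q). {..<n} \<subseteq> run P n I \<omega> t}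
     = ennreal (all_informed_prob P n E q t I)"
proof (induction t arbitrary: I)
  case 0
  interpret product_prob_space "\<lambda>_::nat. measure_pmf (round_pmf n E q)" UNIV ..
  show ?case using P.emeasure_space_1 by (auto simp: rumour_space_def)
next
  case (Suc t)
  let ?M = "measure_pmf (round_pmf n E q)"
  let ?S = "rumour_space n E q"
  let ?F = "all_informed_prob P n E q t"
  interpret sequence_space ?M ..
  have S: "S = ?S" by (simp add: rumour_space_def)
  let ?X = "\<lambda>I t. {\<omega> \<in> space ?S. {..<n} \<subseteq> run P n I \<omega> t}"
  have cn: "(\<lambda>(s, \<omega>). case_nat s \<omega>) \<in> ?M \<Otimes>\<^sub>M ?S \<rightarrow>\<^sub>M ?S" unfolding S[symmetric] by measurable
  have "emeasure ?S (?X I (Suc t)) = emeasure (distr (?M \<Otimes>\<^sub>M ?S) ?S (\<lambda>(s, \<omega>). case_nat s \<omega>)) (?X I (Suc t))"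
    using PiM_iter by (simp add: S)
  also have "\<dots> = emeasure (?M \<Otimes>\<^sub>M ?S) ((\<lambda>(s, \<omega>). case_nat s \<omega>) -` ?X I (Suc t) \<inter> space (?M \<Otimes>\<^sub>M ?S))"
    by (rule emeasure_distr[OF cn sets_run_superset])
  also have "\<dots> = (\<integral>\<^sup>+x. emeasure ?S (Pair x -` ((\<lambda>(s, \<omega>). case_nat s \<omega>) -` ?X I (Suc t) \<inter> space (?M \<Otimes>\<^sub>M ?S))) \<partial>?M)"
    by (rule P.emeasure_pair_measure_alt[unfolded S, OF measurable_sets[OF cn sets_run_superset]])
  also have "\<dots> = (\<integral>\<^sup>+x. emeasure ?S (?X (rumour_step P n I x) t) \<partial>?M)"
  proof (rule nn_integral_cong)
    fix x
    have "space ?S = UNIV" by (simp add: rumour_space_def space_PiM)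
    then have "Pair x -` ((\<lambda>(s, \<omega>). case_nat s \<omega>) -` ?X I (Suc t) \<inter> space (?M \<Otimes>\<^sub>M ?S)) = ?X (rumour_step P n I x) t"
      by (auto simp: space_pair_measure run_case_nat simp del: run.simps)
    then show "emeasure ?S (Pair x -` ((\<lambda>(s, \<omega>). case_nat s \<omega>) -` ?X I (Suc t) \<inter> space (?M \<Otimes>\<^sub>M ?S))) = emeasure ?S (?X (rumour_step P n I x) t)"
      by simp
  qed
  also have "\<dots> = (\<integral>\<^sup>+x. ennreal (?F (rumour_step P n I x)) \<partial>?M)"
    by (simp add: Suc.IH)
  also have "\<dots> = ennreal (all_informed_prob P n E q (Suc t) I)"
    by (simp add: nn_integral_eq_integral integrable_all_informed_prob all_informed_prob_bounds)
  finally show ?case .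
qed

lemma prob_T_less_le_all_informed_prob:
  assumes "x \<le> real t + 1"
  shows "prob_T_less P n E q s x \<le> all_informed_prob P n E q t {s}"
proof -
  let ?S = "rumour_space n E q"
  interpret prob_space ?S unfolding rumour_space_def
    by (intro prob_space_PiM measure_pmf.prob_space_axioms)
  let ?X = "{\<omega> \<in> space ?S. {..<n} \<subseteq> run P n {s} \<omega> t}"
  have "{\<omega> \<in> space ?S. \<exists>t. rounds P n s \<omega> = enat t \<and> real t < x} \<subseteq> ?X"
  proof safe
    fix \<omega> t' v assume *: "rounds P n s \<omega> = enat t'" "real t' < x" "v < n"
    let ?T = "{enat t | t. informed P n s \<omega> t = {..<n}}"
    \<comment> \<open>The infimum of the empty set is infinite, and a nonempty set of
      \<open>enat\<close> contains its infimum.\<close>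
    have "?T \<noteq> {}" using *(1) unfolding rounds_def by (auto simp: Inf_enat_def split: if_splits)
    then have "enat t' \<in> ?T" using *(1) wellorder_InfI unfolding rounds_def by (metis (no_types, lifting) ex_in_conv)
    then have "run P n {s} \<omega> t' = {..<n}" by (simp add: informed_eq_run)
    moreover have "t' \<le> t" using *(2) assms by linarith
    ultimately show "v \<in> run P n {s} \<omega> t" using run_mono_time \<open>v < n\<close> by blast
  qed
  then have "prob_T_less P n E q s x \<le> measure ?S ?X"
    unfolding prob_T_less_def by (intro finite_measure_mono sets_run_superset)
  also have "\<dots> = all_informed_prob P n E q t {s}"
    by (simp add: measure_def emeasure_run_superset all_informed_prob_bounds)
  finally show ?thesis .
qed

section \<open>Growth and survival within one round\<close>

lemma finite_nbrs: "graph_on n E \<Longrightarrow> finite (nbrs E v)"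
proof -
  assume "graph_on n E"
  then have "nbrs E v \<subseteq> {..<n}" unfolding graph_on_def nbrs_def by auto
  then show ?thesis using finite_subset by blast
qed

lemma not_in_own_nbrs: "graph_on n E \<Longrightarrow> v \<notin> nbrs E v"
  unfolding graph_on_def nbrs_def by force

lemma nbrs_sym: "u \<in> nbrs E v \<longleftrightarrow> v \<in> nbrs E u"
  unfolding nbrs_def by (simp add: insert_commute)

section \<open>Marginals of a round at a single vertex\<close>

definition vertex_pmf :: "nat set set \<Rightarrow> real \<Rightarrow> nat \<Rightarrow> (nat option \<times> bool) pmf" where
  "vertex_pmf E q v = pair_pmf (choice_pmf E v) (bernoulli_pmf q)"

lemma prob_round_component:
  assumes "v < n"
  shows "measure_pmf.prob (round_pmf n E q) {x. Q (x v)} = measure_pmf.prob (vertex_pmf E q v) {y. Q y}"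
proof -
  have "map_pmf (\<lambda>x. x v) (round_pmf n E q) = vertex_pmf E q v"
    unfolding round_pmf_def vertex_pmf_def using assms by (subst Pi_pmf_component) auto
  then have "measure_pmf.prob (vertex_pmf E q v) {y. Q y} = measure_pmf.prob (map_pmf (\<lambda>x. x v) (round_pmf n E q)) {y. Q y}"
    by simp
  also have "\<dots> = measure_pmf.prob (round_pmf n E q) {x. Q (x v)}"
    by (simp add: vimage_def)
  finally show ?thesis by simp
qed

lemma prob_vertex_success:
  assumes "0 \<le> q" "q \<le> 1"
  shows "measure_pmf.prob (vertex_pmf E q v) {y. snd y} = q"
proof -
  have "measure_pmf.prob (vertex_pmf E q v) {y. snd y} = measure_pmf.prob (map_pmf snd (vertex_pmf E q v)) {True}"
    by (simp add: vimage_def)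
  also have "\<dots> = q" unfolding vertex_pmf_def map_snd_pair_pmf using assms by (simp add: measure_pmf_single)
  finally show ?thesis .
qed

lemma prob_vertex_target:
  assumes "graph_on n E" "0 \<le> q" "q \<le> 1"
  shows "measure_pmf.prob (vertex_pmf E q v) {(Some u, True)} = (if u \<in> nbrs E v then q / real (degree E v) else 0)"
proof -
  have "pmf (choice_pmf E v) (Some u) = (if u \<in> nbrs E v then 1 / real (degree E v) else 0)"
    using finite_nbrs[OF assms(1), of v]
    by (auto simp: choice_pmf_def pmf_map_inj' degree_def)
  then show ?thesis
    using assms by (simp add: vertex_pmf_def measure_pmf_single pmf_pair)
qed

lemma finite_set_round_pmf:
  assumes "graph_on n E"
  shows "finite (set_pmf (round_pmf n E q))"
proof -
  have "finite (set_pmf (vertex_pmf E q v))" for v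
    using finite_nbrs[OF assms, of v]
    by (auto simp: vertex_pmf_def choice_pmf_def intro: finite_subset[of _ UNIV])
  then show ?thesis
    unfolding round_pmf_def vertex_pmf_def[symmetric] by (subst set_Pi_pmf) auto
qed

lemma integrable_round_pmf:
  "graph_on n E \<Longrightarrow> integrable (measure_pmf (round_pmf n E q)) (f :: _ \<Rightarrow> real)"
  by (intro integrable_measure_pmf_finite finite_set_round_pmf)

lemma expectation_of_bool:
  "measure_pmf.expectation p (\<lambda>x. of_bool (Q x) :: real) = measure_pmf.prob p {x. Q x}"
proof -
  have "(\<lambda>x. of_bool (Q x) :: real) = indicator {x. Q x}" by (auto simp: indicator_def)
  then show ?thesis by simp
qed

section \<open>Expected growth in one round\<close>

text \<open>A pusher adds at most one vertex, whomever it calls, so only its coin is counted. The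
  pull term counts all successful calls into \<open>I\<close>, also those from inside
  \<open>I\<close>.\<close>

lemma card_rumour_step_le:
  assumes "finite I"
  shows "card (rumour_step P n I x) \<le> card I + (\<Sum>v\<in>I. of_bool (v < n \<and> snd (x v)))
     + (if P = PushPull then \<Sum>v<n. \<Sum>u\<in>I. of_bool (x v = (Some u, True)) else 0)"
proof -
  let ?A = "{u. \<exists>v<n. v \<in> I \<and> x v = (Some u, True)}"
  let ?A' = "{v \<in> I. v < n \<and> snd (x v)}"
  let ?B = "{v. P = PushPull \<and> v < n \<and> (\<exists>u\<in>I. x v = (Some u, True))}"
  have "?A \<subseteq> (\<lambda>v. the (fst (x v))) ` ?A'" by force
  moreover have finA': "finite ?A'" using assms by simp
  ultimately have "card ?A \<le> card ((\<lambda>v. the (fst (x v))) ` ?A')" by (intro card_mono) auto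
  also have "\<dots> \<le> card ?A'" using finA' by (rule card_image_le)
  also have "\<dots> = (\<Sum>v\<in>I. of_bool (v < n \<and> snd (x v)))"
    using assms by (simp add: Int_def)
  finally have A: "card ?A \<le> (\<Sum>v\<in>I. of_bool (v < n \<and> snd (x v)))" .
  have B: "card ?B \<le> (if P = PushPull then \<Sum>v<n. \<Sum>u\<in>I. of_bool (x v = (Some u, True)) else 0)"
  proof (cases "P = PushPull")
    case True
    then have "card ?B = (\<Sum>v<n. of_bool (\<exists>u\<in>I. x v = (Some u, True)))"
      by (simp add: Int_def)
    also have "\<dots> \<le> (\<Sum>v<n. \<Sum>u\<in>I. of_bool (x v = (Some u, True)))"
    proof (rule sum_mono)
      fix v
      show "of_bool (\<exists>u\<in>I. x v = (Some u, True)) \<le> (\<Sum>u\<in>I. of_bool (x v = (Some u, True)) :: nat)"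
      proof (cases "\<exists>u\<in>I. x v = (Some u, True)")
        case True
        then obtain u where "u \<in> I" "x v = (Some u, True)" by blast
        then show ?thesis
          using member_le_sum[of u I "\<lambda>u. of_bool (x v = (Some u, True)) :: nat"] assms by simp
      qed simp
    qed
    finally show ?thesis using True by simp
  qed simp
  have "card (rumour_step P n I x) \<le> card (I \<union> ?A) + card ?B"
    unfolding rumour_step_def by (rule card_Un_le)
  also have "\<dots> \<le> card I + card ?A + card ?B" by (simp add: card_Un_le)
  finally show ?thesis using A B by linarith
qed

text \<open>Linearity of expectation; in the pull term the sums are exchanged, so that each informed
  \<open>u\<close> contributes the expected number of successful calls it receives.\<close>

lemma expectation_card_rumour_step_le:
  assumes "graph_on n E" "0 \<le> q" "q \<le> 1" "finite I"
  shows "measure_pmf.expectation (round_pmf n E q) (\<lambda>x. real (card (rumour_step P n I x)))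
    \<le> (1 + q) * real (card I) +
      (if P = PushPull then \<Sum>u\<in>I. \<Sum>v\<in>nbrs E u. q / real (degree E v) else 0)"
proof -
  let ?R = "measure_pmf (round_pmf n E q)"
  note int = integrable_round_pmf[OF assms(1)]
  have push: "(\<Sum>v\<in>I. measure ?R {x. v < n \<and> snd (x v)}) \<le> (\<Sum>v\<in>I. q)"
  proof (rule sum_mono)
    fix v
    show "measure ?R {x. v < n \<and> snd (x v)} \<le> q"
      using prob_round_component[of v n E q snd] assms prob_vertex_success[OF assms(2,3)]
      by (cases "v < n") auto
  qed
  have "(\<Sum>v<n. \<Sum>u\<in>I. measure ?R {x. x v = (Some u, True)})
      = (\<Sum>v<n. \<Sum>u\<in>I. if u \<in> nbrs E v then q / real (degree E v) else 0)"
  proof (intro sum.cong refl)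
    fix v u assume "v \<in> {..<n}"
    then show "measure ?R {x. x v = (Some u, True)} = (if u \<in> nbrs E v then q / real (degree E v) else 0)"
      using prob_round_component[of v n E q "\<lambda>y. y = (Some u, True)"] prob_vertex_target[OF assms(1,2,3)]
      by simp
  qed
  also have "\<dots> = (\<Sum>u\<in>I. \<Sum>v<n. if v \<in> nbrs E u then q / real (degree E v) else 0)"
    by (subst sum.swap) (simp add: nbrs_sym)
  also have "\<dots> = (\<Sum>u\<in>I. \<Sum>v\<in>nbrs E u. q / real (degree E v))"
  proof (rule sum.cong[OF refl])
    fix u
    have "nbrs E u \<subseteq> {..<n}" using assms(1) unfolding graph_on_def nbrs_def by auto
    then show "(\<Sum>v<n. if v \<in> nbrs E u then q / real (degree E v) else 0) = (\<Sum>v\<in>nbrs E u. q / real (degree E v))"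
      by (subst sum.inter_restrict[symmetric]) (auto simp: Int_absorb1)
  qed
  finally have pull: "(\<Sum>v<n. \<Sum>u\<in>I. measure ?R {x. x v = (Some u, True)})
      = (\<Sum>u\<in>I. \<Sum>v\<in>nbrs E u. q / real (degree E v))" .
  have "(\<integral>x. real (card (rumour_step P n I x)) \<partial>?R) \<le>
      (\<integral>x. real (card I + (\<Sum>v\<in>I. of_bool (v < n \<and> snd (x v)))
       + (if P = PushPull then \<Sum>v<n. \<Sum>u\<in>I. of_bool (x v = (Some u, True)) else 0)) \<partial>?R)"
    by (intro integral_mono int of_nat_mono card_rumour_step_le assms)
  also have "\<dots> = real (card I) + (\<Sum>v\<in>I. measure ?R {x. v < n \<and> snd (x v)})
     + (if P = PushPull then \<Sum>v<n. \<Sum>u\<in>I. measure ?R {x. x v = (Some u, True)} else 0)"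
    by (simp add: int Bochner_Integration.integral_sum expectation_of_bool)
  finally show ?thesis using push unfolding pull by (simp add: algebra_simps)
qed

section \<open>Survival of a vertex in one round and in several\<close>

text \<open>Outcomes at \<open>u\<close> that cannot inform \<open>v\<close>, whatever the informed
  set is; under push and pull every successful call by \<open>v\<close> itself counts as dangerous,
  as its target may be informed. Since the informed set does not enter, safety in a round is a
  product event over the callers.\<close>

definition safe_outcomes :: "protocol \<Rightarrow> nat \<Rightarrow> nat \<Rightarrow> (nat option \<times> bool) set" where
  "safe_outcomes P v u = - {y. snd y \<and> (fst y = Some v \<or> (P = PushPull \<and> u = v))}"

definition safe_rounds :: "protocol \<Rightarrow> nat \<Rightarrow> nat \<Rightarrow> (nat \<Rightarrow> nat option \<times> bool) set" where
  "safe_rounds P n v = Pi {..<n} (safe_outcomes P v)"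

lemma safe_not_in_rumour_step:
  assumes "v \<notin> I" "v < n" "x \<in> safe_rounds P n v"
  shows "v \<notin> rumour_step P n I x"
proof
  assume "v \<in> rumour_step P n I x"
  with assms(1) consider u where "u < n" "x u = (Some v, True)"
    | u where "P = PushPull" "x v = (Some u, True)"
    unfolding rumour_step_def by blast
  then show False
  proof cases
    case (1 u)
    then have "x u \<in> safe_outcomes P v u" using assms(3) unfolding safe_rounds_def by (blast intro: Pi_mem)
    with 1 show False by (simp add: safe_outcomes_def)
  next
    case (2 u)
    then have "x v \<in> safe_outcomes P v v" using assms(2,3) unfolding safe_rounds_def by (blast intro: Pi_mem)
    with 2 show False by (simp add: safe_outcomes_def)
  qed
qed

definition hit_prob :: "protocol \<Rightarrow> nat set set \<Rightarrow> real \<Rightarrow> nat \<Rightarrow> nat \<Rightarrow> real" where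
  "hit_prob P E q v u =
     (if u = v then if P = PushPull then q else 0
      else if v \<in> nbrs E u then q / real (degree E u) else 0)"

definition escape_prob :: "protocol \<Rightarrow> nat \<Rightarrow> nat set set \<Rightarrow> real \<Rightarrow> nat \<Rightarrow> real" where
  "escape_prob P n E q v = (\<Prod>u<n. 1 - hit_prob P E q v u)"

lemma prob_unsafe:
  assumes "graph_on n E" "0 \<le> q" "q \<le> 1"
  shows "measure_pmf.prob (vertex_pmf E q u) (- safe_outcomes P v u) = hit_prob P E q v u"
proof (cases "P = PushPull \<and> u = v")
  case True
  then have "- safe_outcomes P v u = {y. snd y}" by (auto simp: safe_outcomes_def)
  then show ?thesis using True prob_vertex_success[OF assms(2,3)] by (simp add: hit_prob_def)
next
  case False
  then have "- safe_outcomes P v u = {(Some v, True)}" by (auto simp: safe_outcomes_def)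
  then show ?thesis
    using False prob_vertex_target[OF assms] not_in_own_nbrs[OF assms(1)]
    by (auto simp: hit_prob_def)
qed

lemma prob_safe_rounds:
  assumes "graph_on n E" "0 \<le> q" "q \<le> 1"
  shows "measure_pmf.prob (round_pmf n E q) (safe_rounds P n v) = escape_prob P n E q v"
proof -
  have "measure_pmf.prob (vertex_pmf E q u) (safe_outcomes P v u) = 1 - hit_prob P E q v u" for u
    using measure_pmf.prob_compl[of "safe_outcomes P v u" "vertex_pmf E q u"] prob_unsafe[OF assms]
    by (simp add: Compl_eq_Diff_UNIV)
  then show ?thesis
    unfolding safe_rounds_def escape_prob_def round_pmf_def vertex_pmf_def[symmetric]
    by (subst measure_Pi_pmf_Pi) auto
qed

text \<open>A vertex cannot push to two targets at once, and a vertex that must not pull has no way to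
  hit a non-neighbour; so survival of two non-adjacent vertices is negatively correlated.\<close>

lemma prob_safe_rounds_Int:
  assumes "graph_on n E" "0 \<le> q" "q \<le> 1" "v \<noteq> w" "w \<notin> nbrs E v"
  shows "measure_pmf.prob (round_pmf n E q) (safe_rounds P n v \<inter> safe_rounds P n w)
      \<le> escape_prob P n E q v * escape_prob P n E q w"
proof -
  have step: "measure_pmf.prob (vertex_pmf E q u) (safe_outcomes P v u \<inter> safe_outcomes P w u)
      \<le> (1 - hit_prob P E q v u) * (1 - hit_prob P E q w u)" for u
  proof -
    let ?U = "- safe_outcomes P v u" and ?V = "- safe_outcomes P w u"
    have compl: "safe_outcomes P v u \<inter> safe_outcomes P w u = UNIV - (?U \<union> ?V)" by auto
    have eq: "measure_pmf.prob (vertex_pmf E q u) (safe_outcomes P v u \<inter> safe_outcomes P w u)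
        = 1 - measure_pmf.prob (vertex_pmf E q u) (?U \<union> ?V)"
      unfolding compl using measure_pmf.prob_compl[of "?U \<union> ?V" "vertex_pmf E q u"] by simp
    have le: "hit_prob P E q v u \<le> measure_pmf.prob (vertex_pmf E q u) (?U \<union> ?V)"
      "hit_prob P E q w u \<le> measure_pmf.prob (vertex_pmf E q u) (?U \<union> ?V)"
      unfolding prob_unsafe[OF assms(1-3), symmetric]
      by (intro measure_pmf.finite_measure_mono; simp)+
    have nn: "0 \<le> hit_prob P E q v u" "0 \<le> hit_prob P E q w u"
      unfolding prob_unsafe[OF assms(1-3), symmetric] by simp_all
    \<comment> \<open>At \<open>u = v\<close> and at \<open>u = w\<close> one of the two hit
      probabilities is 0, since \<open>v\<close> and \<open>w\<close> are not adjacent. Any other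
      \<open>u\<close> has a single target, so the two events are disjoint and 1 - a - b \<le> (1 -
      a) (1 - b).\<close>
    consider "u = v" | "u = w" | "u \<noteq> v" "u \<noteq> w" by blast
    then show ?thesis
    proof cases
      case 1
      then have "hit_prob P E q w u = 0" using assms(4,5) by (simp add: hit_prob_def)
      then show ?thesis using eq le by simp
    next
      case 2
      then have "hit_prob P E q v u = 0" using assms(4,5) nbrs_sym by (auto simp: hit_prob_def)
      then show ?thesis using eq le by simp
    next
      case 3
      then have "?U \<inter> ?V = {}" using assms(4) by (auto simp: safe_outcomes_def)
      then have "measure_pmf.prob (vertex_pmf E q u) (?U \<union> ?V) = hit_prob P E q v u + hit_prob P E q w u"
        by (subst measure_pmf.finite_measure_Union) (simp_all add: prob_unsafe[OF assms(1-3)])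
      then show ?thesis using eq nn by (simp add: algebra_simps)
    qed
  qed
  have "safe_rounds P n v \<inter> safe_rounds P n w
      = Pi {..<n} (\<lambda>u. safe_outcomes P v u \<inter> safe_outcomes P w u)"
    unfolding safe_rounds_def by auto
  then have "measure_pmf.prob (round_pmf n E q) (safe_rounds P n v \<inter> safe_rounds P n w)
      = (\<Prod>u<n. measure_pmf.prob (vertex_pmf E q u) (safe_outcomes P v u \<inter> safe_outcomes P w u))"
    unfolding round_pmf_def vertex_pmf_def[symmetric] by (simp add: measure_Pi_pmf_Pi)
  also have "\<dots> \<le> (\<Prod>u<n. (1 - hit_prob P E q v u) * (1 - hit_prob P E q w u))"
    by (intro prod_mono conjI measure_nonneg step)
  finally show ?thesis by (simp add: escape_prob_def prod.distrib)
qed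

text \<open>Chebyshev's inequality in the form \<open>1[X = 0] \<le> (1 - c X)\<^sup>2\<close>, propagated through the rounds:
  the right-hand side dominates the expectation of this square when \<open>X\<close> counts the vertices of
  \<open>A - I\<close> that stay safe for \<open>k\<close> rounds.\<close>

lemma all_informed_prob_chebyshev:
  assumes "graph_on n E" "0 \<le> q" "q \<le> 1" "A \<subseteq> {..<n}"
    and indep: "\<And>v w. v \<in> A \<Longrightarrow> w \<in> A \<Longrightarrow> w \<notin> nbrs E v"
    and p: "\<And>v. v \<in> A \<Longrightarrow> escape_prob P n E q v = p"
  defines "N \<equiv> \<lambda>I. real (card (A - I))"
  shows "all_informed_prob P n E q k I \<le> 1 - 2 * c * p ^ k * N I
      + c\<^sup>2 * (p ^ k * N I + p ^ (2 * k) * (N I * (N I - 1)))"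
proof (induction k arbitrary: I)
  case 0
  have "N I = 0" if "{..<n} \<subseteq> I"
  proof -
    have "A - I = {}" using assms(4) that by auto
    then show ?thesis unfolding N_def by (simp only: card.empty of_nat_0)
  qed
  moreover have "1 - 2 * c * N I + c\<^sup>2 * (N I + N I * (N I - 1)) = (1 - c * N I)\<^sup>2"
    by (simp add: power2_eq_square algebra_simps)
  ultimately show ?case by simp
next
  case (Suc k)
  let ?R = "measure_pmf (round_pmf n E q)"
  let ?D = "A - I"
  let ?Z = "\<lambda>x. {v \<in> ?D. x \<in> safe_rounds P n v}"
  define z where "z = (\<lambda>x. real (card (?Z x)))"
  note int = integrable_round_pmf[OF assms(1)]
  have finA: "finite A" using assms(4) finite_subset by blast
  then have finD: "finite ?D" by simp
  have z_sum: "z x = (\<Sum>v\<in>?D. of_bool (x \<in> safe_rounds P n v))" for x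
    using finD by (simp add: z_def Int_def)
  have z2: "(z x)\<^sup>2 = (\<Sum>v\<in>?D. \<Sum>w\<in>?D. of_bool (x \<in> safe_rounds P n v \<inter> safe_rounds P n w))" for x
    unfolding z_sum power2_eq_square sum_product by (intro sum.cong refl) auto
  have Ez: "(\<integral>x. z x \<partial>?R) = p * N I"
  proof -
    have "(\<integral>x. z x \<partial>?R) = (\<Sum>v\<in>?D. measure ?R (safe_rounds P n v))"
      unfolding z_sum by (simp add: int Bochner_Integration.integral_sum expectation_of_bool)
    also have "\<dots> = (\<Sum>v\<in>?D. p)"
      using p by (intro sum.cong refl) (simp add: prob_safe_rounds[OF assms(1-3)])
    finally show ?thesis by (simp add: N_def)
  qed
  have Ez2: "(\<integral>x. (z x)\<^sup>2 \<partial>?R) \<le> p * N I + p\<^sup>2 * (N I * (N I - 1))"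
  proof -
    have "(\<integral>x. (z x)\<^sup>2 \<partial>?R) = (\<Sum>v\<in>?D. \<Sum>w\<in>?D. measure ?R (safe_rounds P n v \<inter> safe_rounds P n w))"
      unfolding z2 by (simp add: int Bochner_Integration.integral_sum expectation_of_bool Int_def)
    \<comment> \<open>A diagonal pair contributes \<open>p\<close>; off the diagonal, negative
      correlation bounds a pair by \<open>p\<^sup>2\<close>.\<close>
    also have "\<dots> \<le> (\<Sum>v\<in>?D. \<Sum>w\<in>?D. if w = v then p else p\<^sup>2)"
    proof (intro sum_mono)
      fix v w assume "v \<in> ?D" "w \<in> ?D"
      then show "measure ?R (safe_rounds P n v \<inter> safe_rounds P n w) \<le> (if w = v then p else p\<^sup>2)"
        using prob_safe_rounds_Int[OF assms(1-3), of v w P] indep[of v w] p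
        by (auto simp: prob_safe_rounds[OF assms(1-3)] power2_eq_square)
    qed
    also have "\<dots> = (\<Sum>v\<in>?D. p + p\<^sup>2 * (N I - 1))"
    proof (intro sum.cong refl)
      fix v assume v: "v \<in> ?D"
      have "(\<Sum>w\<in>?D. if w = v then p else p\<^sup>2) = p + (\<Sum>w\<in>?D - {v}. p\<^sup>2)"
        using v finD by (subst sum.remove[of _ v]) auto
      also have "\<dots> = p + p\<^sup>2 * (N I - 1)"
      proof -
        have "card ?D \<ge> 1" using v finD card_gt_0_iff[of ?D] by (simp add: Suc_le_eq) blast
        then have "real (card (?D - {v})) = N I - 1" using v finD by (simp add: N_def of_nat_diff)
        then show ?thesis by simp
      qed
      finally show "(\<Sum>w\<in>?D. if w = v then p else p\<^sup>2) = p + p\<^sup>2 * (N I - 1)" .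
    qed
    finally show ?thesis by (simp add: N_def algebra_simps)
  qed
  \<comment> \<open>The first moment is known exactly and only the second is estimated, so the
    coefficient \<open>p ^ (2 * k)\<close> is the one whose sign matters.\<close>
  have p0: "0 \<le> p ^ (2 * k)" by (simp add: power_mult)
  let ?b = "\<lambda>x. 1 - 2 * c * p ^ k * z x + c\<^sup>2 * (p ^ k * z x + p ^ (2 * k) * ((z x)\<^sup>2 - z x))"
  have "all_informed_prob P n E q (Suc k) I \<le> (\<integral>x. ?b x \<partial>?R)"
    unfolding all_informed_prob.simps
  proof (intro integral_mono int)
    fix x
    \<comment> \<open>Informing everything outside \<open>?Z x\<close> can only increase the
      probability, and what is then left of \<open>A\<close> is exactly \<open>?Z x\<close>.\<close>
    have "rumour_step P n I x \<subseteq> - ?Z x" using safe_not_in_rumour_step assms(4) by blast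
    then have "all_informed_prob P n E q k (rumour_step P n I x) \<le> all_informed_prob P n E q k (- ?Z x)"
      by (rule all_informed_prob_mono)
    also have "\<dots> \<le> ?b x"
    proof -
      have "A - - ?Z x = ?Z x" by auto
      then have "N (- ?Z x) = z x" by (simp add: N_def z_def)
      then show ?thesis using Suc.IH[of "- ?Z x"] by (simp add: power2_eq_square right_diff_distrib)
    qed
    finally show "all_informed_prob P n E q k (rumour_step P n I x) \<le> ?b x" .
  qed
  also have "\<dots> = 1 - 2 * c * p ^ k * (p * N I)
      + c\<^sup>2 * (p ^ k * (p * N I) + p ^ (2 * k) * ((\<integral>x. (z x)\<^sup>2 \<partial>?R) - p * N I))"
    by (simp add: int Ez)
  also have "\<dots> \<le> 1 - 2 * c * p ^ k * (p * N I)
      + c\<^sup>2 * (p ^ k * (p * N I) + p ^ (2 * k) * (p\<^sup>2 * (N I * (N I - 1))))"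
    using Ez2 p0 by (intro add_left_mono mult_left_mono) auto
  finally show ?case by (simp add: power_add power2_eq_square algebra_simps)
qed

lemma all_informed_prob_survivor:
  assumes "graph_on n E" "0 \<le> q" "q \<le> 1" "A \<subseteq> {..<n}"
    and "\<And>v w. v \<in> A \<Longrightarrow> w \<in> A \<Longrightarrow> w \<notin> nbrs E v"
    and "\<And>v. v \<in> A \<Longrightarrow> escape_prob P n E q v = p"
    and pos: "p ^ k > 0" "card (A - I) > 0"
  shows "all_informed_prob P n E q k I \<le> 1 / (p ^ k * real (card (A - I)))"
proof -
  let ?N = "real (card (A - I))"
  \<comment> \<open>The reciprocal of the mean \<open>p ^ k * ?N\<close> of the number of vertices
    that stay safe; with it the bound collapses to \<open>c - c * p ^ k\<close>.\<close>
  define c where "c = 1 / (p ^ k * ?N)"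
  have "all_informed_prob P n E q k I \<le> 1 - 2 * c * p ^ k * ?N
      + c\<^sup>2 * (p ^ k * ?N + p ^ (2 * k) * (?N * (?N - 1)))"
    by (rule all_informed_prob_chebyshev[OF assms(1-6)])
  also have "\<dots> = 1 - 2 * (c * (p ^ k * ?N)) + c * (c * (p ^ k * ?N))
      + (c * (p ^ k * ?N))\<^sup>2 - (c * p ^ k) * (c * (p ^ k * ?N))"
  proof -
    have "p ^ (2 * k) = (p ^ k)\<^sup>2" by (simp add: power_mult mult.commute)
    moreover have "1 - 2 * c * r * M + c\<^sup>2 * (r * M + r\<^sup>2 * (M * (M - 1)))
        = 1 - 2 * (c * (r * M)) + c * (c * (r * M)) + (c * (r * M))\<^sup>2 - (c * r) * (c * (r * M))" for r M :: real
      by (simp add: power2_eq_square algebra_simps)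
    ultimately show ?thesis by presburger
  qed
  also have "\<dots> = c - c * p ^ k"
  proof -
    have "1 / y * y = 1" if "y > 0" for y :: real using that by simp
    from this[of "p ^ k * ?N"] have "c * (p ^ k * ?N) = 1"
      unfolding c_def using pos by (simp only: mult_pos_pos of_nat_0_less_iff)
    then show ?thesis by simp
  qed
  also have "\<dots> \<le> c" using pos by (simp add: c_def)
  finally show ?thesis by (simp add: c_def)
qed

text \<open>The bound is linear in \<open>card I\<close>, so a round of growth passes through it in
  expectation and multiplies the first term by at most \<open>\<rho>\<close>. At the end of the
  growth phase it covers both cases: at least half of \<open>A\<close> is left to survive, or
  \<open>I\<close> is large.\<close>

lemma all_informed_prob_two_phases:
  assumes "graph_on n E" "0 \<le> q" "q \<le> 1" "A \<subseteq> {..<n}"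
    and "\<And>v w. v \<in> A \<Longrightarrow> w \<in> A \<Longrightarrow> w \<notin> nbrs E v"
    and "\<And>v. v \<in> A \<Longrightarrow> escape_prob P n E q v = p"
    and growth: "\<And>I. finite I \<Longrightarrow>
      measure_pmf.expectation (round_pmf n E q) (\<lambda>x. real (card (rumour_step P n I x))) \<le> \<rho> * real (card I)"
    and "\<rho> \<ge> 0" "p ^ k > 0" "A \<noteq> {}"
  shows "finite I \<Longrightarrow> all_informed_prob P n E q (t + k) I
      \<le> \<rho> ^ t * real (card I) * (2 / real (card A)) + 2 / (p ^ k * real (card A))"
proof (induction t arbitrary: I)
  case 0
  have finA: "finite A" using assms(4) finite_subset by blast
  then have cA: "card A > 0" using assms by (simp add: card_gt_0_iff)
  show ?case
  proof (cases "2 * card I < card A")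
    case True
    have "card A - card I \<le> card (A - I)" using 0 by (rule diff_card_le_card_Diff)
    then have *: "real (card A) / 2 \<le> real (card (A - I))" using True by linarith
    then have "card (A - I) > 0" using cA by (metis gr0I half_gt_zero not_le of_nat_0 of_nat_0_less_iff)
    then have "all_informed_prob P n E q k I \<le> 1 / (p ^ k * real (card (A - I)))"
      by (intro all_informed_prob_survivor assms)
    also have "\<dots> \<le> 1 / (p ^ k * (real (card A) / 2))"
      using * assms cA by (intro divide_left_mono mult_left_mono) auto
    finally show ?thesis by (simp add: add_increasing)
  next
    case False
    \<comment> \<open>Markov's inequality in pointwise form: the trivial bound 1 is at most
      \<open>real (card I) * (2 / real (card A))\<close>.\<close>
    have "all_informed_prob P n E q k I \<le> 1" by (rule all_informed_prob_bounds)
    also have "1 \<le> real (card I) * (2 / real (card A))" using False cA by (simp add: field_simps)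
    finally show ?thesis using assms by (simp add: add_increasing2)
  qed
next
  case (Suc t)
  let ?R = "measure_pmf (round_pmf n E q)"
  note int = integrable_round_pmf[OF assms(1)]
  let ?b = "\<lambda>I. \<rho> ^ t * real (card I) * (2 / real (card A)) + 2 / (p ^ k * real (card A))"
  have "all_informed_prob P n E q (Suc t + k) I \<le> (\<integral>x. ?b (rumour_step P n I x) \<partial>?R)"
    unfolding add_Suc all_informed_prob.simps
    by (intro integral_mono int Suc.IH finite_rumour_step Suc.prems)
  also have "\<dots> = \<rho> ^ t * (\<integral>x. real (card (rumour_step P n I x)) \<partial>?R) * (2 / real (card A)) + 2 / (p ^ k * real (card A))"
    by (simp add: int)
  also have "\<dots> \<le> \<rho> ^ t * (\<rho> * real (card I)) * (2 / real (card A)) + 2 / (p ^ k * real (card A))"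
    using growth[OF Suc.prems] assms by (intro add_right_mono mult_right_mono mult_left_mono) auto
  finally show ?case by (simp add: mult_ac)
qed

section \<open>Paths\<close>

definition path_edges :: "nat \<Rightarrow> nat set set" where
  "path_edges n = {{i, Suc i} | i. Suc i < n}"

lemma path_edges_subset_complete: "path_edges n \<subseteq> complete_edges n"
  by (auto simp: path_edges_def insert_in_complete_edges)

lemma nbrs_path_edges: "u \<in> nbrs (path_edges n) v \<Longrightarrow> u \<le> Suc v \<and> v \<le> Suc u"
  by (auto simp: nbrs_def path_edges_def doubleton_eq_iff)

lemma connected_path_edges: "connected_graph n (path_edges n)"
proof (rule connected_graphI)
  show "graph_on n (path_edges n)" by (auto simp: graph_on_def path_edges_def)
  fix v assume "v < n"
  then show "(\<lambda>x y. {x, y} \<in> path_edges n)\<^sup>*\<^sup>* 0 v"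
  proof (induction v)
    case (Suc v)
    then have "{v, Suc v} \<in> path_edges n" by (auto simp: path_edges_def)
    with Suc show ?case by (auto intro: rtranclp.rtrancl_into_rtrancl)
  qed simp
qed

lemma round_pmf_target_in_nbrs:
  assumes "graph_on n E" "x \<in> set_pmf (round_pmf n E q)" "v < n" "x v = (Some u, b)"
  shows "u \<in> nbrs E v"
proof -
  have "x v \<in> set_pmf (pair_pmf (choice_pmf E v) (bernoulli_pmf q))"
    using assms(2,3) unfolding round_pmf_def by (auto simp: set_Pi_pmf PiE_dflt_def)
  then show ?thesis
    using assms(4) finite_nbrs[OF assms(1)] by (auto simp: choice_pmf_def split: if_splits)
qed

text \<open>Along a path the rumour advances at most one position per round, so it stays in an
  interval around \<open>s\<close> with at most \<open>2 * (r + t) + 1\<close> positions. The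
  interval is written with sums to avoid truncated subtraction.\<close>

lemma all_informed_prob_path:
  assumes "I \<subseteq> {u. s \<le> u + r \<and> u \<le> s + r}" "2 * (r + t) + 1 < n"
  shows "all_informed_prob P n (path_edges n) q t I = 0"
  using assms
proof (induction t arbitrary: r I)
  case 0
  have "\<not> {..<n} \<subseteq> I"
  proof
    assume "{..<n} \<subseteq> I"
    also have "I \<subseteq> {s - r..s + r}" using 0 by auto
    finally have "n \<le> card {s - r..s + r}" by (metis card_lessThan card_mono finite_atLeastAtMost)
    then show False using 0 by simp
  qed
  then show ?case by simp
next
  case (Suc t)
  have g: "graph_on n (path_edges n)" using connected_path_edges by (simp add: connected_graph_def)
  have "all_informed_prob P n (path_edges n) q t (rumour_step P n I x) = 0"
    if x: "x \<in> set_pmf (round_pmf n (path_edges n) q)" for x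
  proof (rule Suc.IH[of _ "Suc r"])
    have near: "u \<le> Suc v \<and> v \<le> Suc u" if "v < n" "x v = (Some u, True)" for u v
      using round_pmf_target_in_nbrs[OF g x that] nbrs_path_edges by blast
    show "rumour_step P n I x \<subseteq> {u. s \<le> u + Suc r \<and> u \<le> s + Suc r}"
    proof
      fix w assume "w \<in> rumour_step P n I x"
      then consider "w \<in> I" | v where "v \<in> I" "w \<le> Suc v \<and> v \<le> Suc w"
        unfolding rumour_step_def using near by blast
      then show "w \<in> {u. s \<le> u + Suc r \<and> u \<le> s + Suc r}"
        using Suc.prems(1) by cases fastforce+
    qed
  qed (use Suc.prems(2) in simp)
  then have "measure_pmf.expectation (round_pmf n (path_edges n) q)
      (\<lambda>x. all_informed_prob P n (path_edges n) q t (rumour_step P n I x))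
      = measure_pmf.expectation (round_pmf n (path_edges n) q) (\<lambda>x. 0)"
    by (intro integral_cong_AE) (auto simp: AE_measure_pmf_iff)
  then show ?case by simp
qed

lemma prob_T_less_path_tendsto:
  "(\<lambda>n. prob_T_less P n (path_edges n) q (s n) (C * ln (real n) - 1)) \<longlonglongrightarrow> 0"
proof (rule tendsto_eventually)
  have "eventually (\<lambda>n::nat. C * ln (real n) \<le> real n / 2 - 2) at_top" by real_asymp
  then show "eventually (\<lambda>n. prob_T_less P n (path_edges n) q (s n) (C * ln (real n) - 1) = 0) at_top"
    using eventually_gt_at_top[of 4]
  proof eventually_elim
    case (elim n)
    \<comment> \<open>The largest \<open>t\<close> with \<open>2 * t + 1 < n\<close>.\<close>
    let ?t = "n div 2 - 1"
    have "prob_T_less P n (path_edges n) q (s n) (C * ln (real n) - 1)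
        \<le> all_informed_prob P n (path_edges n) q ?t {s n}"
      by (rule prob_T_less_le_all_informed_prob) (use elim in linarith)
    also have "\<dots> = 0"
      by (rule all_informed_prob_path[where s="s n" and r=0]) (use elim in auto)
    finally show ?case
      by (simp add: prob_T_less_def order_antisym)
  qed
qed

section \<open>The thinned complete graph\<close>

text \<open>The vertices below \<open>m\<close> become an independent set without neighbours below \<open>k\<close>.  All their
  remaining neighbours keep the full degree \<open>n - 1\<close>.\<close>

definition thinned_edges :: "nat \<Rightarrow> nat \<Rightarrow> nat \<Rightarrow> nat set set" where
  "thinned_edges n m k = {e \<in> complete_edges n. \<forall>i j. e = {i, j} \<longrightarrow> \<not> (i < m \<and> j < k)}"

lemma insert_in_thinned_edges:
  "{i, j} \<in> thinned_edges n m k \<longleftrightarrow>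
     i < n \<and> j < n \<and> i \<noteq> j \<and> \<not> (i < m \<and> j < k) \<and> \<not> (j < m \<and> i < k)"
  by (auto simp: thinned_edges_def insert_in_complete_edges doubleton_eq_iff)

lemma thinned_edges_subset_complete: "thinned_edges n m k \<subseteq> complete_edges n"
  by (auto simp: thinned_edges_def)

lemma graph_on_thinned_edges: "graph_on n (thinned_edges n m k)"
  by (auto simp: graph_on_def thinned_edges_def complete_edges_def)

lemma connected_thinned_edges:
  assumes "m \<le> k" "k < n"
  shows "connected_graph n (thinned_edges n m k)"
proof (rule connected_graphI[OF graph_on_thinned_edges])
  \<comment> \<open>The hub \<open>n - 1\<close> is not below \<open>k\<close>, hence keeps all its
    edges.\<close>
  fix v assume "v < n"
  then show "(\<lambda>x y. {x, y} \<in> thinned_edges n m k)\<^sup>*\<^sup>* (n - 1) v"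
    using assms by (cases "v = n - 1") (auto simp: insert_in_thinned_edges)
qed

lemma nbrs_thinned_edges:
  assumes "m \<le> k" "k < n" "v < n"
  shows "nbrs (thinned_edges n m k) v =
    (if v < m then {k..<n} else if v < k then {m..<n} - {v} else {..<n} - {v})"
  using assms by (auto simp: nbrs_def insert_in_thinned_edges)

lemma degree_thinned_edges:
  assumes "m \<le> k" "k < n" "v < n"
  shows "degree (thinned_edges n m k) v =
    (if v < m then n - k else if v < k then n - m - 1 else n - 1)"
  using assms by (simp add: degree_def nbrs_thinned_edges)

text \<open>Only the \<open>n - k\<close> vertices from \<open>k\<close> on can call
  \<open>v\<close>, each with \<open>n - 1\<close> choices; under push and pull its own call adds
  the factor \<open>1 - q\<close>. The value is the same for all \<open>v < m\<close>.\<close>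

lemma escape_prob_thinned_edges:
  assumes "m \<le> k" "k < n" "v < m"
  shows "escape_prob P n (thinned_edges n m k) q v =
    (if P = PushPull then 1 - q else 1) * (1 - q / real (n - 1)) ^ (n - k)"
proof -
  let ?E = "thinned_edges n m k"
  have hit: "hit_prob P ?E q v u = (if u = v then if P = PushPull then q else 0
      else if k \<le> u then q / real (n - 1) else 0)" if "u < n" for u
  proof -
    have "v \<in> nbrs ?E u \<longleftrightarrow> k \<le> u"
      using assms that by (subst nbrs_sym) (simp add: nbrs_thinned_edges)
    moreover have "degree ?E u = n - 1" if "k \<le> u"
      using that \<open>u < n\<close> assms by (simp add: degree_thinned_edges)
    ultimately show ?thesis by (simp add: hit_prob_def)
  qed
  have "escape_prob P n ?E q v = (\<Prod>u\<in>{..<k} \<union> {k..<n}. 1 - hit_prob P ?E q v u)"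
    unfolding escape_prob_def using assms by (intro prod.cong) auto
  also have "\<dots> = (\<Prod>u<k. 1 - hit_prob P ?E q v u) * (\<Prod>u=k..<n. 1 - hit_prob P ?E q v u)"
    by (rule prod.union_disjoint) auto
  also have "(\<Prod>u<k. 1 - hit_prob P ?E q v u) = (\<Prod>u<k. if u = v then if P = PushPull then 1 - q else 1 else 1)"
    using assms by (intro prod.cong refl) (auto simp: hit)
  also have "\<dots> = (if P = PushPull then 1 - q else 1)" using assms by (simp add: prod.delta)
  also have "(\<Prod>u=k..<n. 1 - hit_prob P ?E q v u) = (\<Prod>u=k..<n. 1 - q / real (n - 1))"
    using assms by (intro prod.cong refl) (auto simp: hit)
  finally show ?thesis by (simp only: prod_constant card_atLeastLessThan)
qed

text \<open>The sum is the mean number of calls that \<open>u\<close> receives. The \<open>m\<close>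
  vertices of degree \<open>n - k\<close> account for the first term; every other vertex has degree
  at least \<open>n - m - 1\<close>.\<close>

lemma sum_inverse_degree_thinned_le:
  assumes "m \<le> k" "k < n" "m + 1 < n"
  shows "(\<Sum>v\<in>nbrs (thinned_edges n m k) u. 1 / real (degree (thinned_edges n m k) v))
    \<le> real m / real (n - k) + real n / real (n - m - 1)"
proof -
  let ?E = "thinned_edges n m k"
  have "nbrs ?E u \<subseteq> {..<n}" by (auto simp: nbrs_def insert_in_thinned_edges)
  then have "(\<Sum>v\<in>nbrs ?E u. 1 / real (degree ?E v)) \<le> (\<Sum>v<n. 1 / real (degree ?E v))"
    by (intro sum_mono2) auto
  also have "\<dots> \<le> (\<Sum>v<n. (if v < m then 1 / real (n - k) else 0) + 1 / real (n - m - 1))"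
  proof (rule sum_mono)
    fix v assume "v \<in> {..<n}"
    then show "1 / real (degree ?E v) \<le> (if v < m then 1 / real (n - k) else 0) + 1 / real (n - m - 1)"
      using assms by (auto simp: degree_thinned_edges intro!: divide_left_mono)
  qed
  also have "\<dots> = (\<Sum>v\<in>{..<n} \<inter> {..<m}. 1 / real (n - k)) + real n / real (n - m - 1)"
    by (subst sum.distrib, subst sum.inter_restrict) simp_all
  also have "{..<n} \<inter> {..<m} = {..<m}" using assms by auto
  finally show ?thesis by simp
qed

definition growth_rate :: "protocol \<Rightarrow> nat \<Rightarrow> nat \<Rightarrow> nat \<Rightarrow> real \<Rightarrow> real" where
  "growth_rate P n m k q = 1 + q +
     (if P = PushPull then q * (real m / real (n - k) + real n / real (n - m - 1)) else 0)"

lemma growth_thinned_edges: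
  assumes "m \<le> k" "k < n" "m + 1 < n" "0 \<le> q" "q \<le> 1" "finite I"
  shows "measure_pmf.expectation (round_pmf n (thinned_edges n m k) q)
      (\<lambda>x. real (card (rumour_step P n I x))) \<le> growth_rate P n m k q * real (card I)"
proof -
  let ?E = "thinned_edges n m k"
  let ?\<gamma> = "real m / real (n - k) + real n / real (n - m - 1)"
  have "(\<Sum>u\<in>I. \<Sum>v\<in>nbrs ?E u. q / real (degree ?E v)) \<le> (\<Sum>u\<in>I. q * ?\<gamma>)"
  proof (rule sum_mono)
    fix u
    have "(\<Sum>v\<in>nbrs ?E u. q / real (degree ?E v)) = q * (\<Sum>v\<in>nbrs ?E u. 1 / real (degree ?E v))"
      by (simp add: sum_distrib_left)
    also have "\<dots> \<le> q * ?\<gamma>"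
      using assms by (intro mult_left_mono sum_inverse_degree_thinned_le)
    finally show "(\<Sum>v\<in>nbrs ?E u. q / real (degree ?E v)) \<le> q * ?\<gamma>" .
  qed
  then show ?thesis
    using expectation_card_rumour_step_le[OF graph_on_thinned_edges assms(4-6), of n m k P]
    by (auto simp: growth_rate_def algebra_simps split: if_splits)
qed

definition thinned_escape :: "protocol \<Rightarrow> nat \<Rightarrow> nat \<Rightarrow> real \<Rightarrow> real" where
  "thinned_escape P n k q = (if P = PushPull then 1 - q else 1) * (1 - q / real (n - 1)) ^ (n - k)"

text \<open>The growth phase takes \<open>a\<close> rounds and the survival phase \<open>b\<close>,
  with \<open>{..<m}\<close> as the set whose vertices are hard to reach.\<close>

lemma prob_T_less_thinned_le:
  assumes "m \<le> k" "k < n" "m + 1 < n" "0 < m" "0 \<le> q" "q \<le> 1"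
    and "thinned_escape P n k q ^ b > 0" "x \<le> real (a + b) + 1"
  shows "prob_T_less P n (thinned_edges n m k) q s x
     \<le> growth_rate P n m k q ^ a * (2 / real m) + 2 / (thinned_escape P n k q ^ b * real m)"
proof -
  have "prob_T_less P n (thinned_edges n m k) q s x \<le> all_informed_prob P n (thinned_edges n m k) q (a + b) {s}"
    by (rule prob_T_less_le_all_informed_prob) (use assms in simp)
  also have "\<dots> \<le> growth_rate P n m k q ^ a * real (card {s}) * (2 / real (card {..<m}))
      + 2 / (thinned_escape P n k q ^ b * real (card {..<m}))"
  proof (rule all_informed_prob_two_phases[OF graph_on_thinned_edges assms(5,6)])
    fix v w assume "v \<in> {..<m}" "w \<in> {..<m}"
    then show "w \<notin> nbrs (thinned_edges n m k) v"
      using assms by (simp add: nbrs_thinned_edges)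
  next
    fix v assume "v \<in> {..<m}"
    then show "escape_prob P n (thinned_edges n m k) q v = thinned_escape P n k q"
      using assms by (simp add: escape_prob_thinned_edges thinned_escape_def)
  next
    show "0 \<le> growth_rate P n m k q" using assms by (simp add: growth_rate_def)
  qed (use assms growth_thinned_edges in auto)
  finally show ?thesis by simp
qed

section \<open>Choice of the two sizes and the resulting limits\<close>

text \<open>The largest number of edges that a vertex of degree \<open>n - 1\<close> may
  lose.\<close>

definition deficit_size :: "real \<Rightarrow> nat \<Rightarrow> nat" where
  "deficit_size \<epsilon> n = nat \<lfloor>\<epsilon> * (real n - 1)\<rfloor>"

text \<open>Of order n / ln n: this is o(n), so that the low-degree vertices do not affect the
  limiting growth rate, yet equal to n up to a logarithmic factor, so that no constant is lost on
  the scale ln n. The minimum keeps it at most \<open>deficit_size\<close> for every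
  \<open>n\<close>.\<close>

definition sparse_size :: "real \<Rightarrow> nat \<Rightarrow> nat" where
  "sparse_size \<epsilon> n = min (deficit_size \<epsilon> n) (nat \<lfloor>real n / ln (real n)\<rfloor>)"

abbreviation thinned_seq :: "real \<Rightarrow> nat \<Rightarrow> nat set set" where
  "thinned_seq \<epsilon> n \<equiv> thinned_edges n (sparse_size \<epsilon> n) (deficit_size \<epsilon> n)"

lemma sparse_size_le: "sparse_size \<epsilon> n \<le> deficit_size \<epsilon> n"
  by (simp add: sparse_size_def)

lemma deficit_size_le:
  assumes "0 < \<epsilon>" "n \<ge> 1"
  shows "real (deficit_size \<epsilon> n) \<le> \<epsilon> * (real n - 1)"
proof -
  have "0 \<le> \<epsilon> * (real n - 1)" using assms by simp
  then show ?thesis unfolding deficit_size_def by linarith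
qed

lemma deficit_size_less:
  assumes "0 < \<epsilon>" "\<epsilon> < 1" "n \<ge> 1"
  shows "deficit_size \<epsilon> n < n"
proof -
  have "real (deficit_size \<epsilon> n) \<le> \<epsilon> * (real n - 1)" using assms by (simp add: deficit_size_le)
  also have "\<dots> \<le> 1 * (real n - 1)" using assms by (intro mult_right_mono) auto
  finally have "real (deficit_size \<epsilon> n) < real n" by simp
  then show ?thesis by simp
qed

lemma degree_thinned_seq_ge:
  assumes "0 < \<epsilon>" "\<epsilon> < 1" "n \<ge> 1" "v < n"
  shows "real (degree (thinned_seq \<epsilon> n) v) \<ge> (1 - \<epsilon>) * real (degree (complete_edges n) v)"
proof -
  let ?m = "sparse_size \<epsilon> n" and ?k = "deficit_size \<epsilon> n"
  note le = sparse_size_le[of \<epsilon> n] and lt = deficit_size_less[OF assms(1-3)]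
  have "n - ?k \<le> degree (thinned_seq \<epsilon> n) v \<or> n - 1 - ?k \<le> degree (thinned_seq \<epsilon> n) v \<and> \<not> v < ?m"
    using le lt assms by (auto simp: degree_thinned_edges)
  then have "real n - 1 - real ?k \<le> real (degree (thinned_seq \<epsilon> n) v)"
    using lt by linarith
  moreover have "(1 - \<epsilon>) * real (degree (complete_edges n) v) = real n - 1 - \<epsilon> * (real n - 1)"
    using assms by (simp add: degree_complete_edges of_nat_diff algebra_simps)
  ultimately show ?thesis using deficit_size_le[of \<epsilon> n] assms by linarith
qed

lemma deficit_fraction_tendsto:
  assumes "0 < \<epsilon>"
  shows "(\<lambda>n. real (deficit_size \<epsilon> n) / real n) \<longlonglongrightarrow> \<epsilon>"
proof (rule tendsto_sandwich[OF _ _ _ tendsto_const])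
  show "eventually (\<lambda>n. (\<epsilon> * (real n - 1) - 1) / real n \<le> real (deficit_size \<epsilon> n) / real n) at_top"
    unfolding deficit_size_def by (intro always_eventually allI divide_right_mono) linarith+
  show "eventually (\<lambda>n. real (deficit_size \<epsilon> n) / real n \<le> \<epsilon>) at_top"
    using eventually_ge_at_top[of 1]
  proof eventually_elim
    case (elim n)
    then have "real (deficit_size \<epsilon> n) \<le> \<epsilon> * real n"
      using deficit_size_le[OF assms, of n] assms by (simp add: algebra_simps)
    with elim show ?case by (simp add: field_simps)
  qed
  show "(\<lambda>n. (\<epsilon> * (real n - 1) - 1) / real n) \<longlonglongrightarrow> \<epsilon>" by real_asymp
qed

lemma sparse_size_ge:
  assumes "0 < \<epsilon>"
  shows "eventually (\<lambda>n. real n / ln (real n) - 1 \<le> real (sparse_size \<epsilon> n)) at_top"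
proof -
  have "eventually (\<lambda>n::nat. real n / ln (real n) \<le> \<epsilon> * (real n - 1)) at_top"
    using assms by real_asymp
  then show ?thesis
  proof eventually_elim
    case (elim n)
    have "real n / ln (real n) - 1 \<le> real (deficit_size \<epsilon> n)"
      "real n / ln (real n) - 1 \<le> real (nat \<lfloor>real n / ln (real n)\<rfloor>)"
      unfolding deficit_size_def using elim by linarith+
    then show ?case by (simp add: sparse_size_def min_def)
  qed
qed

lemma sparse_fraction_tendsto: "(\<lambda>n. real (sparse_size \<epsilon> n) / real n) \<longlonglongrightarrow> 0"
proof (rule tendsto_sandwich[OF _ _ tendsto_const])
  show "eventually (\<lambda>n. real (sparse_size \<epsilon> n) / real n \<le> 1 / ln (real n)) at_top"
    using eventually_ge_at_top[of 2]
  proof eventually_elim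
    case (elim n)
    then have ln: "0 < ln (real n)" by simp
    then have "0 \<le> real n / ln (real n)" by simp
    then have "real (nat \<lfloor>real n / ln (real n)\<rfloor>) \<le> real n / ln (real n)" by linarith
    then have "real (sparse_size \<epsilon> n) \<le> real n / ln (real n)" by (simp add: sparse_size_def min_def)
    then have "real (sparse_size \<epsilon> n) / real n \<le> real n / ln (real n) / real n" by (rule divide_right_mono) simp
    with elim show ?case by simp
  qed
  show "(\<lambda>n::nat. 1 / ln (real n)) \<longlonglongrightarrow> 0" by real_asymp
qed (simp add: always_eventually)

definition limit_growth :: "protocol \<Rightarrow> real \<Rightarrow> real" where
  "limit_growth P q = (if P = PushPull then 1 + 2 * q else 1 + q)"

text \<open>In the limit the callers of low degree contribute 0 / (1 - \<epsilon>) and all others 1,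
  so pulling gains as much as pushing.\<close>

lemma growth_rate_tendsto:
  assumes "0 < \<epsilon>" "\<epsilon> < 1"
  shows "(\<lambda>n. growth_rate P n (sparse_size \<epsilon> n) (deficit_size \<epsilon> n) q) \<longlonglongrightarrow> limit_growth P q"
proof -
  let ?m = "\<lambda>n. real (sparse_size \<epsilon> n) / real n" and ?k = "\<lambda>n. real (deficit_size \<epsilon> n) / real n"
  have inv: "(\<lambda>n. 1 / real n) \<longlonglongrightarrow> 0" by real_asymp
  have "(\<lambda>n. ?m n / (1 - ?k n) + 1 / (1 - ?m n - 1 / real n)) \<longlonglongrightarrow> 0 / (1 - \<epsilon>) + 1 / (1 - 0 - 0)"
    using assms by (intro tendsto_intros sparse_fraction_tendsto deficit_fraction_tendsto inv) auto
  moreover have "eventually (\<lambda>n. ?m n / (1 - ?k n) + 1 / (1 - ?m n - 1 / real n)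
      = real (sparse_size \<epsilon> n) / real (n - deficit_size \<epsilon> n) + real n / real (n - sparse_size \<epsilon> n - 1)) at_top"
    using eventually_ge_at_top[of 1]
  proof eventually_elim
    case (elim n)
    have k: "deficit_size \<epsilon> n < n" using assms elim by (rule deficit_size_less)
    then have m: "sparse_size \<epsilon> n + 1 \<le> n" using sparse_size_le[of \<epsilon> n] by simp
    have "1 - ?k n = real (n - deficit_size \<epsilon> n) / real n"
      using k by (simp add: field_simps of_nat_diff)
    moreover have "1 - ?m n - 1 / real n = real (n - sparse_size \<epsilon> n - 1) / real n"
      using m elim by (simp add: field_simps of_nat_diff)
    ultimately show ?case using elim by simp
  qed
  ultimately have "(\<lambda>n. real (sparse_size \<epsilon> n) / real (n - deficit_size \<epsilon> n)
      + real n / real (n - sparse_size \<epsilon> n - 1)) \<longlonglongrightarrow> 1"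
    by (subst (asm) filterlim_cong[OF refl refl]) simp_all
  then have "(\<lambda>n. 1 + q + q * (real (sparse_size \<epsilon> n) / real (n - deficit_size \<epsilon> n)
      + real n / real (n - sparse_size \<epsilon> n - 1))) \<longlonglongrightarrow> 1 + q + q * 1"
    by (intro tendsto_intros)
  then show ?thesis by (simp add: growth_rate_def[abs_def] limit_growth_def algebra_simps)
qed

text \<open>The power in the escape probability tends to exp (- q (1 - \<epsilon>)), since
  \<open>deficit_size\<close> is asymptotically \<epsilon> n. For push and pull with
  \<open>q = 1\<close> the escape probability is 0 and has no logarithm.\<close>

lemma ln_thinned_escape_tendsto:
  assumes "0 < \<epsilon>" "\<epsilon> < 1" "0 < q" "q \<le> 1" "\<not> (P = PushPull \<and> q = 1)"
  shows "(\<lambda>n. ln (thinned_escape P n (deficit_size \<epsilon> n) q)) \<longlonglongrightarrow>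
     (if P = PushPull then ln (1 - q) else 0) - q * (1 - \<epsilon>)"
proof -
  let ?c = "if P = PushPull then 1 - q else 1"
  let ?k = "\<lambda>n. real (deficit_size \<epsilon> n) / real n"
  have c: "?c > 0" using assms by auto
  have "(\<lambda>n::nat. real n * ln (1 - q / (real n - 1))) \<longlonglongrightarrow> - q" using assms by real_asymp
  then have "(\<lambda>n. ln ?c + (1 - ?k n) * (real n * ln (1 - q / (real n - 1)))) \<longlonglongrightarrow> ln ?c + (1 - \<epsilon>) * (- q)"
    by (intro tendsto_intros deficit_fraction_tendsto assms)
  moreover have "eventually (\<lambda>n. ln ?c + (1 - ?k n) * (real n * ln (1 - q / (real n - 1)))
      = ln (thinned_escape P n (deficit_size \<epsilon> n) q)) at_top"
    using eventually_ge_at_top[of 3]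
  proof eventually_elim
    case (elim n)
    have k: "deficit_size \<epsilon> n < n" using assms elim by (intro deficit_size_less) auto
    have pos: "1 - q / real (n - 1) > 0" using assms elim by (simp add: field_simps of_nat_diff)
    have "ln (thinned_escape P n (deficit_size \<epsilon> n) q) = ln ?c + ln ((1 - q / real (n - 1)) ^ (n - deficit_size \<epsilon> n))"
      unfolding thinned_escape_def using c pos by (intro ln_mult_pos) auto
    also have "ln ((1 - q / real (n - 1)) ^ (n - deficit_size \<epsilon> n)) = real (n - deficit_size \<epsilon> n) * ln (1 - q / real (n - 1))"
      using pos by (simp add: ln_realpow)
    also have "real (n - deficit_size \<epsilon> n) = (1 - ?k n) * real n"
      using k by (simp add: field_simps of_nat_diff)
    also have "real (n - 1) = real n - 1" using elim by (simp add: of_nat_diff)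
    finally show ?case by simp
  qed
  ultimately have "(\<lambda>n. ln (thinned_escape P n (deficit_size \<epsilon> n) q)) \<longlonglongrightarrow> ln ?c + (1 - \<epsilon>) * (- q)"
    by (rule Lim_transform_eventually)
  then show ?thesis by (cases P) (simp_all add: algebra_simps)
qed

lemma thinned_escape_pos:
  assumes "0 < q" "q \<le> 1" "\<not> (P = PushPull \<and> q = 1)" "n \<ge> 3"
  shows "0 < thinned_escape P n k q" "thinned_escape P n k q \<le> 1"
proof -
  \<comment> \<open>From \<open>n = 3\<close> on the quotient is at most 1/2; for
    \<open>n = 2\<close> and \<open>q = 1\<close> the difference would vanish.\<close>
  have *: "0 < 1 - q / real (n - 1)" "1 - q / real (n - 1) \<le> 1"
    using assms by (simp_all add: field_simps of_nat_diff)
  then show "0 < thinned_escape P n k q"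
    using assms unfolding thinned_escape_def by (intro mult_pos_pos zero_less_power) auto
  have "(1 - q / real (n - 1)) ^ (n - k) \<le> 1" using * by (intro power_le_one) auto
  then show "thinned_escape P n k q \<le> 1"
    using assms * unfolding thinned_escape_def by (intro mult_le_one zero_le_power) auto
qed

section \<open>Early completion has vanishing probability\<close>

text \<open>For \<open>L = ln (real n)\<close> the right-hand side is n to the power
  \<open>\<theta>\<close>. The base \<open>g\<close> will be the growth rate or the reciprocal of
  the escape probability.\<close>

lemma power_le_powr:
  fixes g \<theta> L :: real
  assumes "1 \<le> g" "real a \<le> \<alpha> * L" "\<alpha> * ln g \<le> \<theta>" "0 \<le> L"
  shows "g ^ a \<le> exp (\<theta> * L)"
proof -
  have "g ^ a = exp (real a * ln g)" using assms by (simp add: exp_of_nat_mult)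
  also have "real a * ln g \<le> \<alpha> * L * ln g" using assms by (intro mult_right_mono) auto
  also have "\<alpha> * L * ln g = \<alpha> * ln g * L" by simp
  also have "\<dots> \<le> \<theta> * L" using assms by (intro mult_right_mono) auto
  finally show ?thesis by simp
qed

text \<open>In units of ln n the phases have lengths just below
  \<open>1 / ln (limit_growth P q)\<close> and \<open>Y\<close>. Once both are shortened by a factor
  below 1, the error terms are of order n^\<theta> / m with \<open>\<theta> < 1\<close> and
  \<open>m\<close> about n / ln n, and vanish. Having \<open>Y\<close> as a parameter lets
  \<open>Y = 0\<close> stand for an empty survival phase, the case of push and pull with
  \<open>q = 1\<close>.\<close>

lemma prob_T_less_thinned_tendsto:
  fixes q \<epsilon> :: real and P :: protocol
  assumes "0 < \<epsilon>" "\<epsilon> < 1" "0 < q" "q \<le> 1"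
  defines "\<kappa> \<equiv> q * (1 - \<epsilon>) - (if P = PushPull then ln (1 - q) else 0)"
  assumes Y: "0 \<le> Y" "Y * \<kappa> \<le> 1" "P = PushPull \<Longrightarrow> q = 1 \<Longrightarrow> Y = 0"
    and C: "C < 1 / ln (limit_growth P q) + Y"
  shows "(\<lambda>n. prob_T_less P n (thinned_seq \<epsilon> n) q (s n) (C * ln (real n) - 1)) \<longlonglongrightarrow> 0"
proof -
  define X where "X = 1 / ln (limit_growth P q)"
  have G1: "limit_growth P q > 1" using assms by (simp add: limit_growth_def)
  then have X: "X > 0" "X * ln (limit_growth P q) = 1" by (simp_all add: X_def)
  \<comment> \<open>The common shortening factor; the maximum covers negative
    \<open>C\<close>.\<close>
  define \<tau> where "\<tau> = max 0 (C / (X + Y))"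
  have \<tau>: "0 \<le> \<tau>" "\<tau> < 1" "C \<le> \<tau> * X + \<tau> * Y"
  proof -
    have XY: "X + Y > 0" using X Y by simp
    show "0 \<le> \<tau>" by (simp add: \<tau>_def)
    show "\<tau> < 1" using C XY by (simp add: \<tau>_def X_def)
    have "C = C / (X + Y) * (X + Y)" using XY by simp
    also have "\<dots> \<le> \<tau> * (X + Y)" using XY by (intro mult_right_mono) (auto simp: \<tau>_def)
    finally show "C \<le> \<tau> * X + \<tau> * Y" by (simp add: distrib_left)
  qed
  \<comment> \<open>A value strictly between \<open>\<tau>\<close> and 1 leaves room for rates that
    only converge to their limits.\<close>
  define \<theta> where "\<theta> = (1 + \<tau>) / 2"
  have \<theta>: "\<tau> < \<theta>" "\<theta> < 1" "0 < \<theta>" using \<tau> by (auto simp: \<theta>_def)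
  let ?m = "sparse_size \<epsilon>" and ?k = "deficit_size \<epsilon>"
  let ?g = "\<lambda>n. growth_rate P n (?m n) (?k n) q"
  let ?p = "\<lambda>n. thinned_escape P n (?k n) q"
  define a where "a n = nat \<lfloor>\<tau> * X * ln (real n)\<rfloor>" for n :: nat
  define b where "b n = nat \<lfloor>\<tau> * Y * ln (real n)\<rfloor>" for n :: nat
  have "(\<lambda>n. \<tau> * X * ln (?g n)) \<longlonglongrightarrow> \<tau> * X * ln (limit_growth P q)"
    using G1 by (intro tendsto_intros growth_rate_tendsto assms) auto
  moreover have "\<tau> * X * ln (limit_growth P q) < \<theta>" using X \<theta> by (simp add: mult.assoc)
  ultimately have ev1: "eventually (\<lambda>n. \<tau> * X * ln (?g n) < \<theta>) at_top" by (rule order_tendstoD)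
  have ev2: "eventually (\<lambda>n. 0 < ?p n ^ b n \<and> 1 / ?p n ^ b n \<le> exp (\<theta> * ln (real n))) at_top"
  proof (cases "P = PushPull \<and> q = 1")
    case True
    then have "b n = 0" for n using Y by (simp add: b_def)
    then show ?thesis
      using \<theta> by (intro eventually_mono[OF eventually_ge_at_top[of 1]]) auto
  next
    case False
    have "(\<lambda>n. \<tau> * Y * - ln (?p n)) \<longlonglongrightarrow> \<tau> * Y * - ((if P = PushPull then ln (1 - q) else 0) - q * (1 - \<epsilon>))"
      using False by (intro tendsto_intros ln_thinned_escape_tendsto assms) auto
    moreover have "\<tau> * Y * - ((if P = PushPull then ln (1 - q) else 0) - q * (1 - \<epsilon>)) < \<theta>"
    proof -
      have "\<tau> * (Y * \<kappa>) \<le> \<tau> * 1" using Y \<tau> by (intro mult_left_mono) auto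
      then show ?thesis using \<theta> by (simp add: \<kappa>_def mult.assoc)
    qed
    ultimately have "eventually (\<lambda>n. \<tau> * Y * - ln (?p n) < \<theta>) at_top" by (rule order_tendstoD)
    then show ?thesis using eventually_ge_at_top[of 3]
    proof eventually_elim
      case (elim n)
      have p: "0 < ?p n" "?p n \<le> 1"
        using thinned_escape_pos[OF assms(3,4) False elim(2)] by auto
      have "0 \<le> \<tau> * Y * ln (real n)" using \<tau> Y elim by simp
      then have "real (b n) \<le> \<tau> * Y * ln (real n)" unfolding b_def by linarith
      moreover have "\<tau> * Y * ln (1 / ?p n) \<le> \<theta>" using elim p by (simp add: ln_div)
      ultimately have "(1 / ?p n) ^ b n \<le> exp (\<theta> * ln (real n))"
        using p elim by (intro power_le_powr) auto
      then show ?case using p by (simp add: power_one_over)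
    qed
  qed
  have ev4: "eventually (\<lambda>n. real (sparse_size \<epsilon> n) / real n < 1 / 2) at_top"
    by (rule order_tendstoD(2)[OF sparse_fraction_tendsto]) simp
  have ev3: "eventually (\<lambda>n::nat. real n / ln (real n) - 1 > 0) at_top" by real_asymp
  let ?B = "\<lambda>n. 4 * exp (\<theta> * ln (real n)) / (real n / ln (real n) - 1)"
  have upper: "eventually (\<lambda>n. prob_T_less P n (thinned_seq \<epsilon> n) q (s n) (C * ln (real n) - 1) \<le> ?B n) at_top"
    using ev1 ev2 ev3 ev4 sparse_size_ge[OF assms(1)] eventually_ge_at_top[of 3]
  proof eventually_elim
    case (elim n)
    have k: "?k n < n" using elim assms by (intro deficit_size_less) auto
    have m: "?m n + 1 < n" using elim by (simp add: field_simps)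
    have "0 < real (?m n)" using elim by linarith
    then have m0: "?m n > 0" by simp
    have ln: "0 \<le> ln (real n)" using elim by simp
    have g1: "1 \<le> ?g n" using assms by (simp add: growth_rate_def)
    have "0 \<le> \<tau> * X * ln (real n)" using \<tau> X ln by simp
    then have "real (a n) \<le> \<tau> * X * ln (real n)" unfolding a_def by linarith
    then have ga: "?g n ^ a n \<le> exp (\<theta> * ln (real n))"
      using elim g1 ln by (intro power_le_powr) auto
    have "C * ln (real n) \<le> (\<tau> * X + \<tau> * Y) * ln (real n)" using \<tau> ln by (intro mult_right_mono) auto
    \<comment> \<open>Each floor loses less than 1. The error term absorbs one of these losses, the
      slack of 1 in the hypothesis of \<open>prob_T_less_thinned_le\<close> the other.\<close>
    also have "\<dots> \<le> real (a n + b n) + 2" unfolding a_def b_def distrib_right by linarith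
    finally have "C * ln (real n) - 1 \<le> real (a n + b n) + 1" by simp
    then have "prob_T_less P n (thinned_seq \<epsilon> n) q (s n) (C * ln (real n) - 1)
        \<le> ?g n ^ a n * (2 / real (?m n)) + 2 / (?p n ^ b n * real (?m n))"
      by (intro prob_T_less_thinned_le sparse_size_le k m m0) (use elim assms(3,4) in auto)
    also have "\<dots> = (?g n ^ a n + 1 / ?p n ^ b n) * 2 / real (?m n)"
      by (simp add: divide_simps)
    also have "\<dots> \<le> (exp (\<theta> * ln (real n)) + exp (\<theta> * ln (real n))) * 2 / real (?m n)"
      using ga elim by (intro divide_right_mono mult_right_mono add_mono) auto
    also have "\<dots> \<le> (exp (\<theta> * ln (real n)) + exp (\<theta> * ln (real n))) * 2 / (real n / ln (real n) - 1)"
      using elim m0 by (intro divide_left_mono) auto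
    finally show ?case by simp
  qed
  have lim: "?B \<longlonglongrightarrow> 0" using \<theta> by real_asymp
  show ?thesis
    by (rule tendsto_sandwich[OF _ upper tendsto_const lim]) (simp add: prob_T_less_def)
qed

section \<open>The constants\<close>

text \<open>The formula is continuous at 1, so it agrees there with its limit.\<close>

lemma c_push_eq:
  assumes "0 < q" "q \<le> 1"
  shows "c_push q = 1 / ln (1 + q) + 1 / q"
proof (cases "q < 1")
  case True
  then show ?thesis by (simp add: c_push_def c_push_formula_def)
next
  case False
  have "((\<lambda>q::real. 1 / ln (1 + q) + 1 / q) \<longlongrightarrow> 1 / ln (1 + 1) + 1 / 1) (at_left 1)"
    by (intro tendsto_intros) auto
  then have "Lim (at_left 1) c_push_formula = 1 / ln (1 + 1) + 1 / 1"
    unfolding c_push_formula_def[abs_def] by (intro tendsto_Lim) auto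
  then show ?thesis using False assms by (simp add: c_push_def)
qed

text \<open>The second summand vanishes in the limit because - ln (1 - q) tends to infinity.\<close>

lemma c_pp_one: "c_pp 1 = 1 / ln 3"
proof -
  have "((\<lambda>q::real. 1 / (q - ln (1 - q))) \<longlongrightarrow> 0) (at_left 1)" by real_asymp
  moreover have "((\<lambda>q::real. 1 / ln (1 + 2 * q)) \<longlongrightarrow> 1 / ln (1 + 2 * 1)) (at_left 1)"
    by (intro tendsto_intros) auto
  ultimately have "((\<lambda>q::real. 1 / ln (1 + 2 * q) + 1 / (q - ln (1 - q))) \<longlongrightarrow> 1 / ln (1 + 2 * 1) + 0) (at_left 1)"
    by (intro tendsto_add)
  then have "Lim (at_left 1) c_pp_formula = 1 / ln (1 + 2 * 1) + 0"
    unfolding c_pp_formula_def[abs_def] by (intro tendsto_Lim) auto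
  then show ?thesis by (simp add: c_pp_def)
qed

section \<open>Rational bounds on the logarithm\<close>

text \<open>By convexity - ln (1 - q) lies below its chord between 0 and \<open>r\<close>; the last
  hypothesis says that this chord has slope at most \<open>c\<close>.\<close>

lemma minus_ln_one_minus_le_chord:
  fixes q r :: real
  assumes "0 < q" "q \<le> r" "r < 1" "exp (- (c * r)) \<le> 1 - r"
  shows "- ln (1 - q) \<le> c * q"
proof -
  have r: "0 < r" using assms by simp
  have "convex_on {0<..} (\<lambda>x::real. - ln x)" by (rule minus_log_convex[of "exp 1", simplified log_def, simplified])
  from convex_onD[OF this, of "q / r" 1 "1 - r"]
  have "- ln ((1 - q / r) * 1 + q / r * (1 - r)) \<le> (1 - q / r) * - ln 1 + q / r * - ln (1 - r)"
    using assms r by simp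
  also have "(1 - q / r) * 1 + q / r * (1 - r) = 1 - q" using r by (simp add: field_simps)
  finally have "- ln (1 - q) \<le> q / r * - ln (1 - r)" by simp
  also have "\<dots> \<le> q / r * (c * r)"
  proof -
    have "ln (exp (- (c * r))) \<le> ln (1 - r)" using assms by (subst ln_le_cancel_iff) auto
    then have "- ln (1 - r) \<le> c * r" by simp
    then show ?thesis using assms r by (intro mult_left_mono) auto
  qed
  also have "\<dots> = c * q" using r by simp
  finally show ?thesis .
qed

text \<open>Partial sums of the exponential series bound exp x from below, which reduces a numerical
  bound to rational arithmetic.\<close>

lemma exp_minus_le_of_partial_sum:
  fixes x y :: real
  assumes "1 \<le> y * (\<Sum>i<N. x ^ i / fact i)" "0 \<le> x" "0 \<le> y"
  shows "exp (- x) \<le> y"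
proof -
  have "(\<Sum>i<N. x ^ i / fact i) \<le> exp x"
  proof -
    have "(\<Sum>i<N. x ^ i /\<^sub>R fact i) \<le> (\<Sum>i. x ^ i /\<^sub>R fact i)"
      by (intro sum_le_suminf summable_exp_generic) (use assms in auto)
    then show ?thesis by (simp add: exp_def divide_inverse mult.commute)
  qed
  then have "1 \<le> y * exp x" using assms by (meson mult_left_mono order_trans)
  then show ?thesis by (simp add: exp_minus field_simps)
qed

text \<open>With slope 9/5, q - ln (1 - q) is at most 14/5 q, and (14/5)^2 < 8 is what
  \<open>push_pull_gain\<close> asks for on this range.\<close>

lemma minus_ln_bound_07:
  fixes q :: real
  assumes "0 < q" "q \<le> 7/10"
  shows "- ln (1 - q) \<le> 9/5 * q"
proof (rule minus_ln_one_minus_le_chord[of q "7/10"])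
  have "exp (- (63/50)) \<le> (3/10 :: real)"
    by (rule exp_minus_le_of_partial_sum[where N=8]) (simp_all add: eval_nat_numeral fact_numeral)
  then show "exp (- (9/5 * (7/10))) \<le> 1 - (7/10 :: real)" by simp
qed (use assms in auto)

text \<open>With slope 13/5, q - ln (1 - q) is at most 18/5 q; as 1/8 - (7/10)^4 / 5 < (5/18)^2,
  this is just enough for \<open>push_pull_gain\<close> once q exceeds 7/10.\<close>

lemma minus_ln_bound_089:
  fixes q :: real
  assumes "0 < q" "q \<le> 89/100"
  shows "- ln (1 - q) \<le> 13/5 * q"
proof (rule minus_ln_one_minus_le_chord[of q "89/100"])
  have "exp (- (1157/500)) \<le> (11/100 :: real)"
    by (rule exp_minus_le_of_partial_sum[where N=10]) (simp_all add: eval_nat_numeral fact_numeral)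
  then show "exp (- (13/5 * (89/100))) \<le> 1 - (89/100 :: real)" by simp
qed (use assms in auto)

text \<open>The right-hand side is the derivative of 1 / (q (1 - \<epsilon>) - ln (1 - q)) at
  \<epsilon> = 0, the first-order gain of the survival phase. A bound q - ln (1 - q) \<le> c q
  reduces the claim to 1/8 - q^4 / 5 < 1 / c^2, with a different \<open>c\<close> on the first two
  ranges.\<close>

lemma push_pull_gain:
  fixes q :: real
  assumes "0 < q" "q < 1"
  shows "1 / (8 * q) - q ^ 3 / 5 < q / (q - ln (1 - q))\<^sup>2"
proof -
  let ?S = "q - ln (1 - q)"
  have "ln (1 - q) < 0" using assms by simp
  then have S: "?S > 0" using assms by linarith
  have bound: "1 / (c\<^sup>2 * q) \<le> q / ?S\<^sup>2" if "?S \<le> c * q" "0 < c" for c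
  proof -
    have "?S\<^sup>2 \<le> (c * q)\<^sup>2" using that S by (intro power_mono) auto
    then have "q / (c * q)\<^sup>2 \<le> q / ?S\<^sup>2" using assms S that by (intro divide_left_mono) auto
    then show ?thesis using assms by (simp add: power2_eq_square)
  qed
  consider "q \<le> 7/10" | "7/10 < q" "q \<le> 89/100" | "89/100 < q" by linarith
  then show ?thesis
  proof cases
    case 1
    have "1 / (8 * q) - q ^ 3 / 5 < 1 / (8 * q)" using assms by simp
    also have "\<dots> \<le> 1 / ((14/5)\<^sup>2 * q)" using assms by (intro divide_left_mono) (auto simp: power2_eq_square)
    also have "\<dots> \<le> q / ?S\<^sup>2" using minus_ln_bound_07[OF assms(1) 1] by (intro bound) auto
    finally show ?thesis .
  next
    case 2
    have "(7/10) ^ 4 < q ^ 4" using 2 by (intro power_strict_mono) auto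
    then have "1 / (8 * q) - q ^ 3 / 5 < 1 / ((18/5)\<^sup>2 * q)"
      using assms by (simp add: field_simps power2_eq_square eval_nat_numeral)
    also have "\<dots> \<le> q / ?S\<^sup>2" using minus_ln_bound_089[OF assms(1) 2(2)] by (intro bound) auto
    finally show ?thesis .
  next
    case 3
    \<comment> \<open>Since (89/100)^4 > 5/8, the left-hand side is negative; this fixes the last
      cut point.\<close>
    have "(89/100) ^ 4 < q ^ 4" using 3 by (intro power_strict_mono) auto
    then have "1 / (8 * q) - q ^ 3 / 5 < 0"
      using assms by (simp add: field_simps eval_nat_numeral)
    also have "0 < q / ?S\<^sup>2" using assms S by simp
    finally show ?thesis .
  qed
qed

lemma constant_one_smallo_ln: "(\<lambda>n::nat. 1 :: real) \<in> o(\<lambda>n. ln (real n))"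
  by real_asymp

section \<open>Comparison with the required constants\<close>

lemma push_thinned_tendsto:
  assumes "0 < \<epsilon>" "\<epsilon> < 1" "0 < q" "q \<le> 1"
  shows "(\<lambda>n. prob_T_less Push n (thinned_seq \<epsilon> n) q (s n)
     (c_push q * ln (real n) + \<epsilon> / (2 * q) * ln (real n) - 1)) \<longlonglongrightarrow> 0"
proof -
  let ?C = "c_push q + \<epsilon> / (2 * q)"
  have "(\<lambda>n. prob_T_less Push n (thinned_seq \<epsilon> n) q (s n) (?C * ln (real n) - 1)) \<longlonglongrightarrow> 0"
  proof (rule prob_T_less_thinned_tendsto[where Y="1 / (q * (1 - \<epsilon>))"])
    \<comment> \<open>Division by q (1 - \<epsilon>) turns this into 1 / q + \<epsilon> / (2 q) < 1
      / (q (1 - \<epsilon>)), where the right-hand side is the length of the survival phase.\<close>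
    have "(1 + \<epsilon> / 2) * (1 - \<epsilon>) < 1"
    proof -
      have "(1 + \<epsilon> / 2) * (1 - \<epsilon>) = 1 - \<epsilon> / 2 - \<epsilon> * \<epsilon> / 2" by (simp add: field_simps)
      also have "\<dots> < 1" using assms(1) mult_pos_pos[OF assms(1) assms(1)] by linarith
      finally show ?thesis .
    qed
    then have "1 + \<epsilon> / 2 < 1 / (1 - \<epsilon>)" using assms by (simp add: less_divide_eq)
    then have "(1 + \<epsilon> / 2) / q < 1 / (1 - \<epsilon>) / q" using assms by (intro divide_strict_right_mono)
    then have "1 / q + \<epsilon> / (2 * q) < 1 / (q * (1 - \<epsilon>))"
      by (simp add: add_divide_distrib mult.commute)
    then show "?C < 1 / ln (limit_growth Push q) + 1 / (q * (1 - \<epsilon>))"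
      using assms by (simp add: c_push_eq limit_growth_def)
  qed (use assms in auto)
  then show ?thesis by (simp add: distrib_right)
qed

lemma push_pull_thinned_tendsto:
  assumes "0 < \<epsilon>" "\<epsilon> < 1" "0 < q" "q \<le> 1"
  shows "(\<lambda>n. prob_T_less PushPull n (thinned_seq \<epsilon> n) q (s n)
     (c_pp q * ln (real n) + (\<epsilon> / (8 * q) - \<epsilon> * q ^ 3 / 5) * ln (real n) - 1)) \<longlonglongrightarrow> 0"
proof -
  let ?C = "c_pp q + (\<epsilon> / (8 * q) - \<epsilon> * q ^ 3 / 5)"
  have "(\<lambda>n. prob_T_less PushPull n (thinned_seq \<epsilon> n) q (s n) (?C * ln (real n) - 1)) \<longlonglongrightarrow> 0"
  proof (cases "q = 1")
    case True
    \<comment> \<open>For \<open>q = 1\<close> the required gain \<epsilon> / 8 - \<epsilon> / 5 is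
      negative, so the growth phase alone is long enough.\<close>
    show ?thesis
    proof (rule prob_T_less_thinned_tendsto[where Y=0])
      show "?C < 1 / ln (limit_growth PushPull q) + 0"
        using True assms by (simp add: c_pp_one limit_growth_def)
    qed (use assms in auto)
  next
    case False
    then have q: "q < 1" using assms by simp
    define S where "S = q - ln (1 - q)"
    define \<kappa> where "\<kappa> = q * (1 - \<epsilon>) - ln (1 - q)"
    have eq: "\<kappa> = S - \<epsilon> * q" by (simp add: S_def \<kappa>_def algebra_simps)
    have "ln (1 - q) < 0" "0 < q * (1 - \<epsilon>)" using assms q by simp_all
    then have \<kappa>: "0 < \<kappa>" unfolding \<kappa>_def by linarith
    have le: "\<kappa> \<le> S" unfolding eq using assms by simp
    then have S: "0 < S" using \<kappa> by linarith
    show ?thesis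
    proof (rule prob_T_less_thinned_tendsto[where Y="1 / \<kappa>"])
      \<comment> \<open>The gain 1 / \<kappa> - 1 / S of the survival phase equals \<epsilon> q / (S
        \<kappa>), which is at least its first-order part \<epsilon> q / S^2 because \<kappa> \<le>
        S.\<close>
      have "\<epsilon> * (1 / (8 * q) - q ^ 3 / 5) < \<epsilon> * (q / S\<^sup>2)"
        unfolding S_def using push_pull_gain[OF assms(3) q] assms by (intro mult_strict_left_mono)
      also have "\<dots> = \<epsilon> * q / (S * S)" by (simp add: power2_eq_square)
      also have "\<dots> \<le> \<epsilon> * q / (S * \<kappa>)"
        using S \<kappa> le assms by (intro divide_left_mono mult_left_mono mult_pos_pos) auto
      also have "\<dots> = 1 / \<kappa> - 1 / S"
      proof -
        have "1 / \<kappa> - 1 / S = (S - \<kappa>) / (S * \<kappa>)" using S \<kappa> by (simp add: field_simps)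
        then show ?thesis by (simp add: eq)
      qed
      finally have "\<epsilon> / (8 * q) - \<epsilon> * q ^ 3 / 5 < 1 / \<kappa> - 1 / S"
        by (simp add: right_diff_distrib)
      then show "?C < 1 / ln (limit_growth PushPull q) + 1 / \<kappa>"
        using q by (simp add: c_pp_def c_pp_formula_def limit_growth_def S_def)
      show "1 / \<kappa> * (q * (1 - \<epsilon>) - (if PushPull = PushPull then ln (1 - q) else 0)) \<le> 1"
        using \<kappa> by (simp add: \<kappa>_def)
    qed (use assms \<kappa> q in auto)
  qed
  then show ?thesis by (simp add: distrib_right)
qed

theorem theorem1p6:
  fixes \<epsilon> q :: real
  assumes "\<epsilon> > 0" and "0 < q" and "q \<le> 1"
  shows "\<exists>G Gt :: nat \<Rightarrow> nat set set.
    expander_seq G \<and>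
    (\<forall>n\<ge>1. Gt n \<subseteq> G n \<and> connected_graph n (Gt n) \<and>
       (\<forall>v<n. real (degree (Gt n) v) \<ge> (1 - \<epsilon>) * real (degree (G n) v))) \<and>
    (\<exists>h :: nat \<Rightarrow> real. (\<forall>n. h n > 0) \<and> h \<in> o(\<lambda>n. ln (real n)) \<and>
       (\<forall>s :: nat \<Rightarrow> nat. (\<forall>n\<ge>1. s n < n) \<longrightarrow>
          ((\<lambda>n. prob_T_less Push n (Gt n) q (s n)
                 (c_push q * ln (real n) + \<epsilon> / (2 * q) * ln (real n) - h n)) \<longlongrightarrow> 0) at_top)) \<and>
    (\<exists>h :: nat \<Rightarrow> real. (\<forall>n. h n > 0) \<and> h \<in> o(\<lambda>n. ln (real n)) \<and>
       (\<forall>s :: nat \<Rightarrow> nat. (\<forall>n\<ge>1. s n < n) \<longrightarrow>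
          ((\<lambda>n. prob_T_less PushPull n (Gt n) q (s n)
                 (c_pp q * ln (real n) + (\<epsilon> / (8 * q) - \<epsilon> * q ^ 3 / 5) * ln (real n) - h n)) \<longlongrightarrow> 0) at_top))"
proof (cases "\<epsilon> < 1")
  case True
  show ?thesis
  proof (rule exI[of _ complete_edges], rule exI[of _ "thinned_seq \<epsilon>"], intro conjI exI[of _ "\<lambda>_. 1"] allI impI)
    fix n :: nat assume n: "n \<ge> 1"
    show "thinned_seq \<epsilon> n \<subseteq> complete_edges n" by (rule thinned_edges_subset_complete)
    show "connected_graph n (thinned_seq \<epsilon> n)"
      using assms True n by (intro connected_thinned_edges sparse_size_le deficit_size_less)
    fix v assume "v < n"
    then show "real (degree (thinned_seq \<epsilon> n) v) \<ge> (1 - \<epsilon>) * real (degree (complete_edges n) v)"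
      using assms True n by (intro degree_thinned_seq_ge)
  next
    fix s :: "nat \<Rightarrow> nat"
    show "(\<lambda>n. prob_T_less Push n (thinned_seq \<epsilon> n) q (s n)
       (c_push q * ln (real n) + \<epsilon> / (2 * q) * ln (real n) - 1)) \<longlonglongrightarrow> 0"
      using assms True by (intro push_thinned_tendsto) auto
  next
    fix s :: "nat \<Rightarrow> nat"
    show "(\<lambda>n. prob_T_less PushPull n (thinned_seq \<epsilon> n) q (s n)
       (c_pp q * ln (real n) + (\<epsilon> / (8 * q) - \<epsilon> * q ^ 3 / 5) * ln (real n) - 1)) \<longlonglongrightarrow> 0"
      using assms True by (intro push_pull_thinned_tendsto) auto
  qed (auto simp: expander_seq_complete constant_one_smallo_ln)
next
  case False
  show ?thesis
  proof (rule exI[of _ complete_edges], rule exI[of _ path_edges], intro conjI exI[of _ "\<lambda>_. 1"] allI impI)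
    fix n :: nat assume "n \<ge> 1"
    show "path_edges n \<subseteq> complete_edges n" by (rule path_edges_subset_complete)
    show "connected_graph n (path_edges n)" by (rule connected_path_edges)
    fix v
    \<comment> \<open>The fraction to be kept is not positive, so the degrees may drop
      arbitrarily.\<close>
    have "(1 - \<epsilon>) * real (degree (complete_edges n) v) \<le> 0"
      using False by (intro mult_nonpos_nonneg) auto
    also have "0 \<le> real (degree (path_edges n) v)" by simp
    finally show "real (degree (path_edges n) v) \<ge> (1 - \<epsilon>) * real (degree (complete_edges n) v)" .
  next
    fix s :: "nat \<Rightarrow> nat"
    show "(\<lambda>n. prob_T_less Push n (path_edges n) q (s n)
       (c_push q * ln (real n) + \<epsilon> / (2 * q) * ln (real n) - 1)) \<longlonglongrightarrow> 0"
      unfolding distrib_right[symmetric] by (rule prob_T_less_path_tendsto)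
    show "(\<lambda>n. prob_T_less PushPull n (path_edges n) q (s n)
       (c_pp q * ln (real n) + (\<epsilon> / (8 * q) - \<epsilon> * q ^ 3 / 5) * ln (real n) - 1)) \<longlonglongrightarrow> 0"
      unfolding distrib_right[symmetric] by (rule prob_T_less_path_tendsto)
  qed (auto simp: expander_seq_complete constant_one_smallo_ln)
qed

end
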